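(* Let $U=ae_r+be_\theta+ce_z$ be an axisymmetric solution of the Euler equation on the solid torus $M$ with pressure $P$ and initial velocity $U_0=a_0e_r+b_0e_\theta+c_0e_z$. Suppose $c_0$ is odd in $z$, $a_0$ is even in $z$, and $b_0$ is odd or even in $z$. Let $\mathfrak b_0=\partial_rb_0(0,0)$ (derivative at $r=0,z=0$) and $\mathfrak b_1=b_0(1,0)$ (value at $r=1,z=0$). Then, for either $r_0=0$ or $r_0=1$, any of the following is sufficient to ensure blowup in finite time: \begin{itemize} \item $P_{rr}(t,r_0,0)\ge 0$ for all $t$, and initially $a_r(0,r_0,0)<0$ and $\mathfrak b_{r_0}=0$; \item $P_{zz}(t,r_0,0)\ge 0$ for all $t$, and initially $c_z(0,r_0,0)<0$. \end{itemize} (Arguments of $P,a,c$ are $(t,r,z)$.)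
   Context: Configuration domain: $M=\{(x,y,z): x^2+y^2\le 1,\ -\pi\le z\le \pi\}/\{(x,y,-\pi)\equiv(x,y,\pi)\}$ with the flat metric and cylindrical coordinates $(r,\theta,z)$; $e_r,e_\theta,e_z$ are the usual cylindrical unit vector fields. An axisymmetric velocity field is $U=ae_r+be_\theta+ce_z$ with $a,b,c$ functions of $(t,r,z)$ only; $U$ is tangent to $\partial M$ (i.e. $a=0$ at $r=1$). The Euler equation is $U_t+U\cdot\nabla U=-\nabla P$, $\operatorname{div}U=0$, $U|_{t=0}=U_0$, where the axisymmetric pressure $P=P(t,r,z)$ is determined (up to a function of time) by $\Delta P=-\operatorname{Tr}((\nabla U)^2)$ with $\langle\nabla P,e_r\rangle=-\langle U\cdot\nabla U,e_r\rangle$ at $r=1$. Solutions are assumed smooth on their maximal interval of existence. Odd/even in $z$ refers to the reflection $z\mapsto -z$ of $z\in[-\pi,\pi]$. Subscripts $r,z,t$ on $a,c,P$ denote partial derivatives. "For all $t$" means for all $t\ge 0$ in the interval of existence, and "blowup in finite time" means that the maximal time of existence of the smooth solution is finite. *)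

theory Defs
  imports "HOL-Analysis.Analysis"
begin

text \<open>
  The solid torus is represented by its universal cover in the axial direction: functions on it
  are functions on the infinite closed cylinder that are 2*pi-periodic in the third coordinate.
  All derivatives are taken within the closed cylinder, so that they are meaningful (and unique)
  up to the boundary.
\<close>

definition cylinder :: "(real ^ 3) set" where
  "cylinder = {x. (x $ 1)\<^sup>2 + (x $ 2)\<^sup>2 \<le> 1}"

definition z_periodic :: "(real ^ 3 \<Rightarrow> 'b) \<Rightarrow> bool" where
  "z_periodic f \<longleftrightarrow> (\<forall>x\<in>cylinder. f (x + vector [0, 0, 2 * pi]) = f x)"

primrec Ck_on :: "nat \<Rightarrow> 'a::real_normed_vector set \<Rightarrow> ('a \<Rightarrow> 'b::real_normed_vector) \<Rightarrow> bool" where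
  "Ck_on 0 S f \<longleftrightarrow> continuous_on S f"
| "Ck_on (Suc k) S f \<longleftrightarrow>
     (\<exists>f'. (\<forall>x\<in>S. (f has_derivative f' x) (at x within S)) \<and> (\<forall>v. Ck_on k S (\<lambda>x. f' x v)))"

definition smooth_on :: "'a::real_normed_vector set \<Rightarrow> ('a \<Rightarrow> 'b::real_normed_vector) \<Rightarrow> bool" where
  "smooth_on S f \<longleftrightarrow> (\<forall>k. Ck_on k S f)"

definition divergence :: "(real ^ 3 \<Rightarrow> real ^ 3) \<Rightarrow> real ^ 3 \<Rightarrow> real" where
  "divergence V x = trace (jacobian V (at x within cylinder))"

definition gradient :: "(real ^ 3 \<Rightarrow> real) \<Rightarrow> real ^ 3 \<Rightarrow> real ^ 3" where
  "gradient f x = (\<chi> i. frechet_derivative f (at x within cylinder) (axis i 1))"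

definition laplacian :: "(real ^ 3 \<Rightarrow> real) \<Rightarrow> real ^ 3 \<Rightarrow> real" where
  "laplacian f = divergence (gradient f)"

definition advection :: "(real ^ 3 \<Rightarrow> real ^ 3) \<Rightarrow> real ^ 3 \<Rightarrow> real ^ 3" where
  "advection V x = jacobian V (at x within cylinder) *v V x"

definition cyl :: "real \<Rightarrow> real \<Rightarrow> real \<Rightarrow> real ^ 3" where
  "cyl r \<theta> z = vector [r * cos \<theta>, r * sin \<theta>, z]"

definition e_r :: "real \<Rightarrow> real ^ 3" where
  "e_r \<theta> = vector [cos \<theta>, sin \<theta>, 0]"

definition e_theta :: "real \<Rightarrow> real ^ 3" where
  "e_theta \<theta> = vector [- sin \<theta>, cos \<theta>, 0]"

definition e_z :: "real ^ 3" where
  "e_z = vector [0, 0, 1]"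

text \<open>
  At \<open>r = 0\<close> the equation is required for every \<open>\<theta>\<close>, which forces \<open>a 0 z = b 0 z = 0\<close>,
  as it must be for a continuous axisymmetric field.
\<close>

definition axisymmetric_field ::
  "(real ^ 3 \<Rightarrow> real ^ 3) \<Rightarrow> (real \<Rightarrow> real \<Rightarrow> real) \<Rightarrow> (real \<Rightarrow> real \<Rightarrow> real) \<Rightarrow> (real \<Rightarrow> real \<Rightarrow> real) \<Rightarrow> bool"
where
  "axisymmetric_field V a b c \<longleftrightarrow>
     (\<forall>r\<in>{0..1}. \<forall>\<theta> z. V (cyl r \<theta> z) = a r z *\<^sub>R e_r \<theta> + b r z *\<^sub>R e_theta \<theta> + c r z *\<^sub>R e_z)"

definition axisymmetric_scalar :: "(real ^ 3 \<Rightarrow> real) \<Rightarrow> (real \<Rightarrow> real \<Rightarrow> real) \<Rightarrow> bool" where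
  "axisymmetric_scalar f p \<longleftrightarrow> (\<forall>r\<in>{0..1}. \<forall>\<theta> z. f (cyl r \<theta> z) = p r z)"

definition time_interval :: "ereal \<Rightarrow> real set" where
  "time_interval T = {t. 0 \<le> t \<and> ereal t < T}"

definition is_pressure :: "(real ^ 3 \<Rightarrow> real) \<Rightarrow> (real ^ 3 \<Rightarrow> real ^ 3) \<Rightarrow> bool" where
  "is_pressure q V \<longleftrightarrow>
     smooth_on cylinder q \<and> z_periodic q \<and>
     (\<forall>x\<in>cylinder. laplacian q x =
        - trace (jacobian V (at x within cylinder) ** jacobian V (at x within cylinder))) \<and>
     (\<forall>\<theta> z. gradient q (cyl 1 \<theta> z) \<bullet> e_r \<theta> = - (advection V (cyl 1 \<theta> z) \<bullet> e_r \<theta>))"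

text \<open>
  The pressure is only smooth in space: it is determined up to an arbitrary function of time.
\<close>

definition euler_solution ::
  "ereal \<Rightarrow> (real ^ 3 \<Rightarrow> real ^ 3) \<Rightarrow> (real \<Rightarrow> real ^ 3 \<Rightarrow> real ^ 3) \<Rightarrow> (real \<Rightarrow> real ^ 3 \<Rightarrow> real) \<Rightarrow> bool"
where
  "euler_solution T U0 U P \<longleftrightarrow>
     0 < T \<and>
     smooth_on (time_interval T \<times> cylinder) (\<lambda>(t, x). U t x) \<and>
     (\<forall>x\<in>cylinder. U 0 x = U0 x) \<and>
     (\<forall>t\<in>time_interval T.
        z_periodic (U t) \<and>
        is_pressure (P t) (U t) \<and>
        (\<forall>\<theta> z. U t (cyl 1 \<theta> z) \<bullet> e_r \<theta> = 0) \<and>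
        (\<forall>x\<in>cylinder. divergence (U t) x = 0) \<and>
        (\<forall>x\<in>cylinder.
           vector_derivative (\<lambda>s. U s x) (at t within time_interval T) + advection (U t) x
             = - gradient (P t) x))"

definition maximal_euler_solution ::
  "ereal \<Rightarrow> (real ^ 3 \<Rightarrow> real ^ 3) \<Rightarrow> (real \<Rightarrow> real ^ 3 \<Rightarrow> real ^ 3) \<Rightarrow> (real \<Rightarrow> real ^ 3 \<Rightarrow> real) \<Rightarrow> bool"
where
  "maximal_euler_solution T U0 U P \<longleftrightarrow>
     euler_solution T U0 U P \<and>
     \<not> (\<exists>T' U' P'. T < T' \<and> euler_solution T' U0 U' P' \<and>
          (\<forall>t\<in>time_interval T. \<forall>x\<in>cylinder. U' t x = U t x))"

text \<open>
  Partial derivatives in the coordinates \<open>(r, z)\<close>; the radial one is one-sided at \<open>r = 0\<close>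
  and \<open>r = 1\<close>.
\<close>

definition partial_r :: "(real \<Rightarrow> real \<Rightarrow> real) \<Rightarrow> real \<Rightarrow> real \<Rightarrow> real" where
  "partial_r f r z = vector_derivative (\<lambda>s. f s z) (at r within {0..1})"

definition partial_z :: "(real \<Rightarrow> real \<Rightarrow> real) \<Rightarrow> real \<Rightarrow> real \<Rightarrow> real" where
  "partial_z f r z = deriv (\<lambda>s. f r s) z"

definition odd_in_z :: "(real \<Rightarrow> real \<Rightarrow> real) \<Rightarrow> bool" where
  "odd_in_z f \<longleftrightarrow> (\<forall>r\<in>{0..1}. \<forall>z\<in>{-pi..pi}. f r (- z) = - f r z)"

definition even_in_z :: "(real \<Rightarrow> real \<Rightarrow> real) \<Rightarrow> bool" where
  "even_in_z f \<longleftrightarrow> (\<forall>r\<in>{0..1}. \<forall>z\<in>{-pi..pi}. f r (- z) = f r z)"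

definition swirl_coeff :: "(real \<Rightarrow> real \<Rightarrow> real) \<Rightarrow> real \<Rightarrow> real" where
  "swirl_coeff b r0 = (if r0 = 0 then partial_r b 0 0 else b 1 0)"

end

(* On the half plane theta = 0 the axisymmetric Euler system becomes a planar system for (a, b, c, p)(t, r, z).
   Reflecting z, and changing the sign of b if b_0 is odd, maps solutions to solutions, so by uniqueness (the energy
   method with the measure r dr dz) c stays odd in z; hence c = 0 on z = 0, while a = 0 at r = 0 and at r = 1.
   Differentiating the r-momentum equation in r, or the z-momentum equation in z, at (r_0, 0) therefore leaves only
   (a_r)_t = - (a_r)^2 - P_rr, respectively (c_z)_t = - (c_z)^2 - P_zz; for the former, the centrifugal term b^2 / r
   has zero r-derivative because the vanishing of the swirl coefficient at (r_0, 0) is propagated by the theta-momentum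
   equation. With the sign condition on P this is a Riccati inequality with negative initial value, which has no
   solution on [0, infinity). *)
theory Submission
  imports Defs
begin

section \<open>Differential inequalities and mixed partial derivatives\<close>

text \<open>Negating the claim gives \<open>T = \<infinity>\<close>, so all times lie in
  \<open>{0..}\<close> and derivatives are one-sided at \<open>t = 0\<close>, \<open>r = 0\<close>
  and \<open>r = 1\<close>. Two obstacles shape the rest. The pressure is smooth only in space, at
  each fixed time, so no time derivative may fall on it. The time derivatives of a_r and c_z are
  therefore obtained by exchanging mixed derivatives of the velocity alone, and the momentum
  equations are differentiated only in space. The coordinates degenerate on the axis. The quotients
  \<open>B\<^sup>2 / r\<close> and \<open>A * B / r\<close> tend to 0 there, which is also their
  value under \<open>x / 0 = 0\<close>, so the planar equations can be stated up to
  \<open>r = 0\<close>. In the energy estimate the weight \<open>r\<close> of the measure clears the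
  denominators, and the factors \<open>A\<close> and \<open>B\<close> that remain without a weight
  are bounded by a multiple of \<open>r\<close>. When the equations are differentiated at
  \<open>r = 0\<close>, the quotients are treated by difference quotients. Working with the planar
  system also makes the reflection cheap: it is a change of signs of coefficient functions, and no
  reflected field in space has to be differentiated.\<close>

lemma at_within_convex_neq_bot:
  fixes S :: "'a::real_normed_vector set"
  assumes "convex S" "x \<in> S" "y \<in> S" "x \<noteq> y"
  shows "at x within S \<noteq> bot"
  using connected_imp_perfect[of S x] assms convex_connected trivial_limit_within
  by (metis singletonD)

text \<open>Time derivatives of a solution are one-sided at \<open>t = 0\<close>; at interior times
  the derivative within \<open>{0..}\<close> is the ordinary one, and at 0 continuity is
  enough.\<close>

lemma nonincreasing_halfline:
  fixes f :: "real \<Rightarrow> real"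
  assumes deriv: "\<And>t. 0 \<le> t \<Longrightarrow> t \<le> \<tau> \<Longrightarrow> (f has_real_derivative f' t) (at t within {0..})"
    and nonpos: "\<And>t. 0 \<le> t \<Longrightarrow> t \<le> \<tau> \<Longrightarrow> f' t \<le> 0"
    and "0 \<le> \<tau>"
  shows "f \<tau> \<le> f 0"
proof (rule DERIV_nonpos_imp_decreasing_open[OF \<open>0 \<le> \<tau>\<close>])
  fix x :: real assume x: "0 < x" "x < \<tau>"
  have "x \<in> interior {0..}" using x by (simp add: interior_real_atLeast)
  then have "at x within {0..} = at x" by (rule at_within_interior)
  then show "\<exists>y. (f has_real_derivative y) (at x) \<and> y \<le> 0"
    using deriv[of x] nonpos[of x] x by auto
next
  show "continuous_on {0..\<tau>} f"
    unfolding continuous_on_eq_continuous_within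
    by (auto intro!: DERIV_continuous[OF DERIV_subset[OF deriv]])
qed

lemma gronwall_zero:
  fixes y :: "real \<Rightarrow> real"
  assumes deriv: "\<And>t. 0 \<le> t \<Longrightarrow> t \<le> \<tau> \<Longrightarrow> (y has_real_derivative y' t) (at t within {0..})"
    and bound: "\<And>t. 0 \<le> t \<Longrightarrow> t \<le> \<tau> \<Longrightarrow> y' t \<le> K * y t"
    and "y 0 = 0" "0 \<le> \<tau>"
  shows "y \<tau> \<le> 0"
proof -
  define f where "f t = exp (- K * t) * y t" for t
  have "f \<tau> \<le> f 0"
  proof (rule nonincreasing_halfline)
    fix t :: real assume t: "0 \<le> t" "t \<le> \<tau>"
    show "(f has_real_derivative exp (- K * t) * (y' t - K * y t)) (at t within {0..})"
      unfolding f_def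
      by (rule derivative_eq_intros deriv[OF t] refl | simp add: algebra_simps)+
    show "exp (- K * t) * (y' t - K * y t) \<le> 0"
      using bound[OF t] by (simp add: mult_nonneg_nonpos)
  qed fact
  then show ?thesis using \<open>y 0 = 0\<close> by (simp add: f_def mult_le_0_iff)
qed

text \<open>The Gronwall bound is one-sided, so it is applied to \<open>y\<^sup>2\<close>, with
  \<open>K\<close> a bound for \<open>k\<close> on the compact interval up to \<open>\<tau>\<close>.
  This is how a vanishing swirl coefficient is propagated in time.\<close>

lemma linear_ode_zero:
  fixes y k :: "real \<Rightarrow> real"
  assumes deriv: "\<And>t. 0 \<le> t \<Longrightarrow> (y has_real_derivative k t * y t) (at t within {0..})"
    and k: "continuous_on {0..} k" and "y 0 = 0" "0 \<le> \<tau>"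
  shows "y \<tau> = 0"
proof -
  have "bounded (k ` {0..\<tau>})"
    by (intro compact_imp_bounded compact_continuous_image continuous_on_subset[OF k]) auto
  then obtain K where "\<forall>x\<in>k ` {0..\<tau>}. norm x \<le> K"
    unfolding bounded_iff by blast
  then have K: "\<bar>k t\<bar> \<le> K" if "t \<in> {0..\<tau>}" for t
    using that by auto
  have "(y \<tau>)\<^sup>2 \<le> 0"
  proof (rule gronwall_zero[where y = "\<lambda>t. (y t)\<^sup>2" and K = "2 * K"])
    fix t :: real assume t: "0 \<le> t" "t \<le> \<tau>"
    show "((\<lambda>t. (y t)\<^sup>2) has_real_derivative 2 * k t * (y t)\<^sup>2) (at t within {0..})"
      by (rule derivative_eq_intros deriv t refl | simp add: power2_eq_square)+
    show "2 * k t * (y t)\<^sup>2 \<le> 2 * K * (y t)\<^sup>2"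
      using K[of t] t by (intro mult_right_mono) auto
  qed (use assms in auto)
  then show ?thesis by simp
qed

text \<open>Since \<open>y\<close> never rises above \<open>y 0 < 0\<close>, the function
  \<open>- 1 / y\<close> is defined for all times, stays positive, and decreases at rate at least 1,
  which is impossible on a half line.\<close>

lemma riccati_blowup:
  fixes y :: "real \<Rightarrow> real"
  assumes deriv: "\<And>t. 0 \<le> t \<Longrightarrow> (y has_real_derivative y' t) (at t within {0..})"
    and bound: "\<And>t. 0 \<le> t \<Longrightarrow> y' t \<le> - (y t)\<^sup>2"
    and neg: "y 0 < 0"
  shows False
proof -
  have y: "y t \<le> y 0" if "0 \<le> t" for t
  proof (rule nonincreasing_halfline[where f' = y'])
    show "y' s \<le> 0" if "0 \<le> s" for s
      using bound[OF that] by (rule order_trans) simp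
  qed (use that deriv in auto)
  \<comment> \<open>The time at which the solution of y' = -y^2 with the same initial value becomes
    infinite.\<close>
  define \<tau> where "\<tau> = - 1 / y 0"
  have "0 \<le> \<tau>" using neg by (simp add: \<tau>_def divide_nonpos_neg)
  have "\<tau> - 1 / y \<tau> \<le> 0 - 1 / y 0"
  proof (rule nonincreasing_halfline)
    fix t :: real assume t: "0 \<le> t" "t \<le> \<tau>"
    have nz: "y t < 0" using y[of t] t neg by simp
    show "((\<lambda>t. t - 1 / y t) has_real_derivative 1 + y' t / (y t)\<^sup>2) (at t within {0..})"
      using nz by (auto intro!: derivative_eq_intros deriv t simp: power2_eq_square)
    show "1 + y' t / (y t)\<^sup>2 \<le> 0"
      using bound[of t] t nz by (simp add: field_simps)
  qed fact
  then have "1 / y \<tau> \<ge> 0" by (simp add: \<tau>_def)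
  moreover have "y \<tau> < 0" using y[OF \<open>0 \<le> \<tau>\<close>] neg by simp
  ultimately show False by (simp add: zero_le_divide_iff)
qed

text \<open>The exchange is needed at boundary points of the domain, where derivatives are
  one-sided. Hence \<open>f t s\<close> is written as \<open>f 0 s\<close> plus the time integral of
  \<open>ft\<close>, the integral is differentiated in \<open>s\<close> under the integral sign at
  \<open>s0\<close>, and the result is differentiated in time by the fundamental theorem.\<close>

lemma derivative_of_derivative_swap:
  fixes f ft fts :: "real \<Rightarrow> real \<Rightarrow> real" and fs :: "real \<Rightarrow> real"
  assumes dt: "\<And>t s. 0 \<le> t \<Longrightarrow> s \<in> {l..u} \<Longrightarrow> ((\<lambda>t. f t s) has_real_derivative ft t s) (at t within {0..})"
    and ds: "\<And>t. 0 \<le> t \<Longrightarrow> ((\<lambda>s. f t s) has_real_derivative fs t) (at s0 within {l..u})"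
    and dts: "\<And>t s. 0 \<le> t \<Longrightarrow> s \<in> {l..u} \<Longrightarrow> ((\<lambda>s. ft t s) has_real_derivative fts t s) (at s within {l..u})"
    and ct: "\<And>s. s \<in> {l..u} \<Longrightarrow> continuous_on {0..} (\<lambda>t. ft t s)"
    and cts: "continuous_on ({0..} \<times> {l..u}) (\<lambda>(t, s). fts t s)"
    and s0: "s0 \<in> {l..u}" "l < u" and "0 \<le> \<tau>"
  shows "(fs has_real_derivative fts \<tau> s0) (at \<tau> within {0..})"
proof -
  have nb: "at s0 within {l..u} \<noteq> bot"
    using s0 at_within_convex_neq_bot[of "{l..u}" s0 l] at_within_convex_neq_bot[of "{l..u}" s0 u]
    by (cases "s0 = l") auto
  have fs: "fs t = fs 0 + integral {0..t} (\<lambda>x. fts x s0)" if t: "0 \<le> t" for t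
  proof -
    have eq: "f 0 s + integral {0..t} (\<lambda>x. ft x s) = f t s" if s: "s \<in> {l..u}" for s
    proof -
      have "((\<lambda>x. ft x s) has_integral (f t s - f 0 s)) {0..t}"
        by (rule fundamental_theorem_of_calculus[OF t])
           (auto simp flip: has_real_derivative_iff_has_vector_derivative
             intro!: DERIV_subset[OF dt[OF _ s]])
      then show ?thesis by (simp add: integral_unique)
    qed
    have "((\<lambda>s. integral (cbox 0 t) (\<lambda>x. ft x s)) has_real_derivative
        integral (cbox 0 t) (\<lambda>x. fts x s0)) (at s0 within {l..u})"
    proof (rule leibniz_rule_field_derivative[where f = "\<lambda>s x. ft x s" and fx = "\<lambda>s x. fts x s"])
      show "continuous_on ({l..u} \<times> cbox 0 t) (\<lambda>(s, x). fts x s)"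
        unfolding split_def
        by (rule continuous_on_compose2[OF cts[unfolded split_def], where f = "\<lambda>p. (snd p, fst p)", simplified])
           (auto intro!: continuous_intros)
    next
      fix s assume "s \<in> {l..u}"
      then show "(\<lambda>x. ft x s) integrable_on cbox 0 t"
        by (intro integrable_continuous continuous_on_subset[OF ct]) auto
    qed (use s0 dts in auto)
    then have "((\<lambda>s. f 0 s + integral {0..t} (\<lambda>x. ft x s)) has_real_derivative
        fs 0 + integral {0..t} (\<lambda>x. fts x s0)) (at s0 within {l..u})"
      by (intro DERIV_add ds) auto
    then have "((\<lambda>s. f t s) has_real_derivative fs 0 + integral {0..t} (\<lambda>x. fts x s0)) (at s0 within {l..u})"
      by (rule has_field_derivative_transform_within[OF _ zero_less_one]) (use s0 eq in auto)
    from has_field_derivative_unique[OF ds[OF t] this nb] show ?thesis .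
  qed
  have cont: "continuous_on {0..\<tau> + 1} (\<lambda>x. fts x s0)"
    by (rule continuous_on_compose2[OF cts[unfolded split_def], where f = "\<lambda>x. (x, s0)", simplified])
       (use s0 in \<open>auto intro!: continuous_intros\<close>)
  have "((\<lambda>t. integral {0..t} (\<lambda>x. fts x s0)) has_real_derivative fts \<tau> s0) (at \<tau> within {0..\<tau> + 1})"
    using integral_has_real_derivative[OF cont] \<open>0 \<le> \<tau>\<close> by simp
  then have "((\<lambda>t. fs 0 + integral {0..t} (\<lambda>x. fts x s0)) has_real_derivative fts \<tau> s0) (at \<tau> within {0..\<tau> + 1})"
    by (auto intro!: derivative_eq_intros)
  then have "(fs has_real_derivative fts \<tau> s0) (at \<tau> within {0..\<tau> + 1})"
    by (rule has_field_derivative_transform_within[OF _ zero_less_one]) (use \<open>0 \<le> \<tau>\<close> fs[symmetric] in auto)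
  moreover have "at \<tau> within {0..\<tau> + 1} = at \<tau> within {0..}"
    by (rule at_within_nhd[of _ "{..<\<tau> + 1}"]) auto
  ultimately show ?thesis by simp
qed

section \<open>Functions of class C1 up to the boundary of the half plane, and the flux
  integral\<close>

definition cont3 :: "(real \<Rightarrow> real \<Rightarrow> real \<Rightarrow> real) \<Rightarrow> bool" where
  "cont3 f \<longleftrightarrow> continuous_on ({0..} \<times> {0..1} \<times> UNIV) (\<lambda>(t, r, z). f t r z)"

definition cont2 :: "(real \<Rightarrow> real \<Rightarrow> real) \<Rightarrow> bool" where
  "cont2 f \<longleftrightarrow> continuous_on ({0..1} \<times> UNIV) (\<lambda>(r, z). f r z)"

lemma cont3_intros:
  "cont3 (\<lambda>t r z. k)"
  "cont3 (\<lambda>t r z. r)"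
  "cont3 f \<Longrightarrow> cont3 (\<lambda>t r z. - f t r z)"
  "cont3 f \<Longrightarrow> cont3 (\<lambda>t r z. (f t r z)\<^sup>2)"
  "cont3 f \<Longrightarrow> cont3 g \<Longrightarrow> cont3 (\<lambda>t r z. f t r z + g t r z)"
  "cont3 f \<Longrightarrow> cont3 g \<Longrightarrow> cont3 (\<lambda>t r z. f t r z - g t r z)"
  "cont3 f \<Longrightarrow> cont3 g \<Longrightarrow> cont3 (\<lambda>t r z. f t r z * g t r z)"
  unfolding cont3_def split_def by (intro continuous_intros; assumption)+

lemma cont2_intros:
  "cont2 (\<lambda>r z. k)"
  "cont2 (\<lambda>r z. r)"
  "cont2 f \<Longrightarrow> cont2 (\<lambda>r z. - f r z)"
  "cont2 f \<Longrightarrow> cont2 (\<lambda>r z. (f r z)\<^sup>2)"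
  "cont2 f \<Longrightarrow> cont2 g \<Longrightarrow> cont2 (\<lambda>r z. f r z + g r z)"
  "cont2 f \<Longrightarrow> cont2 g \<Longrightarrow> cont2 (\<lambda>r z. f r z - g r z)"
  "cont2 f \<Longrightarrow> cont2 g \<Longrightarrow> cont2 (\<lambda>r z. f r z * g r z)"
  unfolding cont2_def split_def by (intro continuous_intros; assumption)+

lemma cont3_compose:
  assumes "cont3 f" "continuous_on S \<phi>" "\<phi> ` S \<subseteq> {0..} \<times> {0..1} \<times> UNIV"
  shows "continuous_on S (\<lambda>x. f (fst (\<phi> x)) (fst (snd (\<phi> x))) (snd (snd (\<phi> x))))"
  using continuous_on_compose2[OF assms(1)[unfolded cont3_def] assms(2,3)]
  by (simp add: split_def)

lemma cont3_reflect: "cont3 f \<Longrightarrow> cont3 (\<lambda>t r z. f t r (- z))"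
  unfolding cont3_def[of "\<lambda>t r z. f t r (- z)"] split_def
  by (rule cont3_compose[where \<phi> = "\<lambda>p. (fst p, fst (snd p), - snd (snd p))", simplified])
     (auto intro!: continuous_intros)

lemma cont3_imp_cont2: "cont3 f \<Longrightarrow> 0 \<le> t \<Longrightarrow> cont2 (f t)"
  unfolding cont2_def split_def
  by (rule cont3_compose[where \<phi> = "\<lambda>p. (t, fst p, snd p)", simplified])
     (auto intro!: continuous_intros)

lemma cont3_bounded:
  assumes "cont3 f"
  obtains M where "\<And>t r z. 0 \<le> t \<Longrightarrow> t \<le> \<tau> \<Longrightarrow> r \<in> {0..1} \<Longrightarrow> z \<in> {-pi..pi} \<Longrightarrow> \<bar>f t r z\<bar> \<le> M"
proof -
  have "compact ((\<lambda>(t, r, z). f t r z) ` ({0..\<tau>} \<times> {0..1} \<times> {-pi..pi}))"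
    by (intro compact_continuous_image compact_Times continuous_on_subset[OF assms[unfolded cont3_def]]) auto
  then obtain M where "\<forall>x\<in>(\<lambda>(t, r, z). f t r z) ` ({0..\<tau>} \<times> {0..1} \<times> {-pi..pi}). norm x \<le> M"
    using compact_imp_bounded bounded_iff by metis
  then show ?thesis by (intro that[of M]) force
qed

text \<open>The form suited to the pressure at a fixed time. Derivatives are explicit arguments, so
  that sums, reflections and equations can be formed with them directly; \<open>z\<close> runs over
  the whole periodic cover, so its derivative is two-sided.\<close>

definition C1_rz :: "(real \<Rightarrow> real \<Rightarrow> real) \<Rightarrow> (real \<Rightarrow> real \<Rightarrow> real) \<Rightarrow> (real \<Rightarrow> real \<Rightarrow> real) \<Rightarrow> bool" where
  "C1_rz f fr fz \<longleftrightarrow> cont2 f \<and> cont2 fr \<and> cont2 fz \<and>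
     (\<forall>r\<in>{0..1}. \<forall>z. ((\<lambda>s. f s z) has_real_derivative fr r z) (at r within {0..1}) \<and>
        ((\<lambda>s. f r s) has_real_derivative fz r z) (at z))"

definition C1_trz where
  "C1_trz f ft fr fz \<longleftrightarrow> cont3 f \<and> cont3 ft \<and> cont3 fr \<and> cont3 fz \<and>
     (\<forall>t\<ge>0. \<forall>r\<in>{0..1}. \<forall>z.
        ((\<lambda>s. f s r z) has_real_derivative ft t r z) (at t within {0..}) \<and>
        ((\<lambda>s. f t s z) has_real_derivative fr t r z) (at r within {0..1}) \<and>
        ((\<lambda>s. f t r s) has_real_derivative fz t r z) (at z))"

lemma C1_trz_imp_C1_rz: "C1_trz f ft fr fz \<Longrightarrow> 0 \<le> t \<Longrightarrow> C1_rz (f t) (fr t) (fz t)"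
  unfolding C1_trz_def C1_rz_def by (auto intro: cont3_imp_cont2)

lemma C1_rz_diff:
  "C1_rz f fr fz \<Longrightarrow> C1_rz g gr gz \<Longrightarrow>
   C1_rz (\<lambda>r z. f r z - g r z) (\<lambda>r z. fr r z - gr r z) (\<lambda>r z. fz r z - gz r z)"
  unfolding C1_rz_def by (auto intro!: cont2_intros derivative_intros)

lemma C1_rz_reflect:
  assumes "C1_rz f fr fz"
  shows "C1_rz (\<lambda>r z. f r (- z)) (\<lambda>r z. fr r (- z)) (\<lambda>r z. - fz r (- z))"
proof -
  have c: "cont2 (\<lambda>r z. g r (- z))" if "cont2 g" for g
    unfolding cont2_def split_def
    by (rule continuous_on_compose2[OF that[unfolded cont2_def split_def],
          where f = "\<lambda>p. (fst p, - snd p)", simplified])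
       (auto intro!: continuous_intros)
  show ?thesis
    using assms
    unfolding C1_rz_def by (simp add: c cont2_intros(3) DERIV_mirror[where f = "f r" for r, symmetric])
qed

lemma C1_trz_diff:
  "C1_trz f ft fr fz \<Longrightarrow> C1_trz g gt gr gz \<Longrightarrow>
   C1_trz (\<lambda>t r z. f t r z - g t r z) (\<lambda>t r z. ft t r z - gt t r z)
     (\<lambda>t r z. fr t r z - gr t r z) (\<lambda>t r z. fz t r z - gz t r z)"
  unfolding C1_trz_def by (auto intro!: cont3_intros derivative_intros)

lemma C1_trz_scale:
  assumes "C1_trz f ft fr fz"
  shows "C1_trz (\<lambda>t r z. k * f t r z) (\<lambda>t r z. k * ft t r z) (\<lambda>t r z. k * fr t r z) (\<lambda>t r z. k * fz t r z)"
  using assms unfolding C1_trz_def by (auto intro!: cont3_intros DERIV_cmult)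

lemma C1_trz_reflect:
  assumes "C1_trz f ft fr fz"
  shows "C1_trz (\<lambda>t r z. f t r (- z)) (\<lambda>t r z. ft t r (- z)) (\<lambda>t r z. fr t r (- z)) (\<lambda>t r z. - fz t r (- z))"
  using assms unfolding C1_trz_def by (simp add: cont3_reflect cont3_intros(3) DERIV_mirror[where f = "f t r" for t r, symmetric])

text \<open>The measure \<open>r dr dz\<close> makes \<open>(X, Z)\<close> divergence free, so \<open>X f\<^sub>r + Z f\<^sub>z\<close> is a pure flux.\<close>

lemma integral_transport_eq_0:
  assumes f: "C1_rz f fr fz" and X: "C1_rz X Xr Xz" and Z: "C1_rz Z Zr Zz"
    and div: "\<And>r z. r \<in> {0..1} \<Longrightarrow> r * Xr r z + X r z + r * Zz r z = 0"
    and wall: "\<And>z. X 1 z = 0"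
    and per: "\<And>r. r \<in> {0..1} \<Longrightarrow> f r pi = f r (-pi)" "\<And>r. r \<in> {0..1} \<Longrightarrow> Z r pi = Z r (-pi)"
  shows "((\<lambda>(r, z). r * (X r z * fr r z + Z r z * fz r z)) has_integral 0) (cbox (0, -pi) (1, pi))"
proof -
  \<comment> \<open>\<open>g\<close> is the r-derivative of \<open>r * X * f\<close> and
    \<open>h\<close> the z-derivative of \<open>r * Z * f\<close>; by \<open>div\<close> their sum
    is the integrand of the claim.\<close>
  define g where "g r z = X r z * f r z + r * Xr r z * f r z + r * X r z * fr r z" for r z
  define h where "h r z = r * (Zz r z * f r z + Z r z * fz r z)" for r z
  have c: "cont2 f" "cont2 fr" "cont2 fz" "cont2 X" "cont2 Xr" "cont2 Z" "cont2 Zz"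
    using assms by (auto simp: C1_rz_def)
  have dr: "((\<lambda>r. f r z) has_real_derivative fr r z) (at r within {0..1})"
      "((\<lambda>r. X r z) has_real_derivative Xr r z) (at r within {0..1})"
    and dz: "((\<lambda>z. f r z) has_real_derivative fz r z) (at z)"
      "((\<lambda>z. Z r z) has_real_derivative Zz r z) (at z)"
    if "r \<in> {0..1}" for r z
    using f X Z that by (simp_all add: C1_rz_def)
  have "cont2 g" unfolding g_def by (intro cont2_intros c)
  then have g: "continuous_on (cbox (0, -pi) (1, pi)) (\<lambda>(r, z). g r z)"
    unfolding cont2_def by (rule continuous_on_subset) auto
  have "cont2 h" unfolding h_def by (intro cont2_intros c)
  then have h: "continuous_on (cbox (0, -pi) (1, pi)) (\<lambda>(r, z). h r z)"
    unfolding cont2_def by (rule continuous_on_subset) auto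
  \<comment> \<open>The boundary term at \<open>r = 0\<close> dies by the weight, the one at
    \<open>r = 1\<close> by \<open>wall\<close>; in the z-direction periodicity makes the two ends
    cancel.\<close>
  have "((\<lambda>r. g r z) has_integral (1 * X 1 z * f 1 z - 0 * X 0 z * f 0 z)) {0..1}" for z
  proof (rule fundamental_theorem_of_calculus, simp, unfold has_real_derivative_iff_has_vector_derivative[symmetric])
    fix r :: real assume r: "r \<in> {0..1}"
    show "((\<lambda>r. r * X r z * f r z) has_real_derivative g r z) (at r within {0..1})"
      unfolding g_def
      by (rule derivative_eq_intros refl dr[OF r] | simp add: algebra_simps)+
  qed
  from integral_unique[OF this] have "integral {0..1} (\<lambda>r. g r z) = 0" for z
    by (simp add: wall)
  then have "integral (cbox (0, -pi) (1, pi)) (\<lambda>(r, z). g r z) = 0"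
    using integral_prod_continuous[OF g] integral_swap_continuous[OF g] by simp
  then have g0: "((\<lambda>(r, z). g r z) has_integral 0) (cbox (0, -pi) (1, pi))"
    using integrable_integral[OF integrable_continuous[OF g]] by simp
  have "((\<lambda>z. h r z) has_integral (r * Z r pi * f r pi - r * Z r (-pi) * f r (-pi))) {-pi..pi}"
    if r: "r \<in> {0..1}" for r
  proof (rule fundamental_theorem_of_calculus, simp, unfold has_real_derivative_iff_has_vector_derivative[symmetric])
    fix z :: real
    show "((\<lambda>z. r * Z r z * f r z) has_real_derivative h r z) (at z within {-pi..pi})"
      unfolding h_def
      by (rule DERIV_subset[OF _ subset_UNIV])
         (rule derivative_eq_intros refl dz[OF r] | simp add: algebra_simps)+
  qed
  from integral_unique[OF this] have "integral (cbox (-pi) pi) (h r) = 0" if "r \<in> {0..1}" for r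
    using per that by simp
  then have "integral (cbox 0 1) (\<lambda>r. integral (cbox (-pi) pi) (h r)) = integral (cbox 0 1) (\<lambda>r::real. 0::real)"
    by (intro integral_cong) auto
  then have "integral (cbox (0, -pi) (1, pi)) (\<lambda>(r, z). h r z) = 0"
    using integral_prod_continuous[OF h] by simp
  then have h0: "((\<lambda>(r, z). h r z) has_integral 0) (cbox (0, -pi) (1, pi))"
    using integrable_integral[OF integrable_continuous[OF h]] by simp
  have "((\<lambda>p. (\<lambda>(r, z). g r z) p + (\<lambda>(r, z). h r z) p) has_integral 0) (cbox (0, -pi) (1, pi))"
    using has_integral_add[OF g0 h0] by simp
  then show ?thesis
  proof (rule has_integral_eq[rotated])
    fix p assume "p \<in> cbox (0::real, -pi) (1, pi)"
    then obtain r z where p: "p = (r, z)" "r \<in> {0..1}" by (cases p) auto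
    have "g r z + h r z = r * (X r z * fr r z + Z r z * fz r z) + (r * Xr r z + X r z + r * Zz r z) * f r z"
      by (simp add: g_def h_def algebra_simps)
    then show "(\<lambda>(r, z). g r z) p + (\<lambda>(r, z). h r z) p = (\<lambda>(r, z). r * (X r z * fr r z + Z r z * fz r z)) p"
      using div[OF p(2)] by (simp add: p)
  qed
qed

section \<open>Uniqueness for the axisymmetric Euler system on the half plane\<close>

text \<open>Bounds \<open>A / r\<close> and \<open>B / r\<close>, the coefficients that are singular on the axis.\<close>

lemma vanishing_on_axis_bound:
  assumes f: "C1_trz f ft fr fz" and axis: "\<And>t z. 0 \<le> t \<Longrightarrow> f t 0 z = 0"
    and M: "\<And>t r z. 0 \<le> t \<Longrightarrow> t \<le> \<tau> \<Longrightarrow> r \<in> {0..1} \<Longrightarrow> z \<in> {-pi..pi} \<Longrightarrow> \<bar>fr t r z\<bar> \<le> M"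
    and t: "0 \<le> t" "t \<le> \<tau>" "r \<in> {0..1}" "z \<in> {-pi..pi}"
  shows "\<bar>f t r z\<bar> \<le> M * r"
proof -
  have "norm (f t r z - f t 0 z) \<le> M * norm (r - 0)"
    by (rule field_differentiable_bound[where S = "{0..1}" and f' = "\<lambda>r. fr t r z"])
       (use f M t in \<open>auto simp: C1_trz_def\<close>)
  then show ?thesis using axis t by simp
qed

text \<open>The divergence equation is multiplied by \<open>r\<close>, which is the form needed for
  flux integrals. The momentum equations include \<open>r = 0\<close>, where the quotients read 0;
  this is their limit, since \<open>A\<close> and \<open>B\<close> vanish there. For
  \<open>p\<close> only spatial regularity at each time is asked.\<close>

locale meridional_euler =
  fixes A At Ar Az B Bt Br Bz C Ct Cr Cz p pr pz :: "real \<Rightarrow> real \<Rightarrow> real \<Rightarrow> real"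
  assumes A: "C1_trz A At Ar Az" and B: "C1_trz B Bt Br Bz" and C: "C1_trz C Ct Cr Cz"
    and p: "\<And>t. 0 \<le> t \<Longrightarrow> C1_rz (p t) (pr t) (pz t)"
    and periodic: "\<And>t r z. 0 \<le> t \<Longrightarrow> r \<in> {0..1} \<Longrightarrow>
      A t r (z + 2 * pi) = A t r z \<and> B t r (z + 2 * pi) = B t r z \<and>
      C t r (z + 2 * pi) = C t r z \<and> p t r (z + 2 * pi) = p t r z"
    and axis: "\<And>t z. 0 \<le> t \<Longrightarrow> A t 0 z = 0" "\<And>t z. 0 \<le> t \<Longrightarrow> B t 0 z = 0"
    and wall: "\<And>t z. 0 \<le> t \<Longrightarrow> A t 1 z = 0"
    and div: "\<And>t r z. 0 \<le> t \<Longrightarrow> r \<in> {0..1} \<Longrightarrow> r * Ar t r z + A t r z + r * Cz t r z = 0"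
    and momentum_r: "\<And>t r z. 0 \<le> t \<Longrightarrow> r \<in> {0..1} \<Longrightarrow>
      At t r z + A t r z * Ar t r z + C t r z * Az t r z - (B t r z)\<^sup>2 / r = - pr t r z"
    and momentum_theta: "\<And>t r z. 0 \<le> t \<Longrightarrow> r \<in> {0..1} \<Longrightarrow>
      Bt t r z + A t r z * Br t r z + C t r z * Bz t r z + A t r z * B t r z / r = 0"
    and momentum_z: "\<And>t r z. 0 \<le> t \<Longrightarrow> r \<in> {0..1} \<Longrightarrow>
      Ct t r z + A t r z * Cr t r z + C t r z * Cz t r z = - pz t r z"
begin

lemma periodic_pi:
  assumes "0 \<le> t" "r \<in> {0..1}"
  shows "A t r pi = A t r (-pi)" "B t r pi = B t r (-pi)" "C t r pi = C t r (-pi)" "p t r pi = p t r (-pi)"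
  using periodic[OF assms, of "-pi"] by simp_all

text \<open>\<open>B\<close> enters the radial equation only through its square and its own equation
  linearly, so any sign \<open>\<epsilon>\<close> is admissible. The factor \<open>-1 *\<close> in
  front of \<open>C\<close> lets \<open>C\<close> be handled by the same scaling lemma as
  \<open>B\<close>.\<close>

lemma reflected:
  assumes "\<epsilon> * \<epsilon> = (1::real)"
  shows "meridional_euler (\<lambda>t r z. A t r (-z)) (\<lambda>t r z. At t r (-z)) (\<lambda>t r z. Ar t r (-z)) (\<lambda>t r z. - Az t r (-z))
    (\<lambda>t r z. \<epsilon> * B t r (-z)) (\<lambda>t r z. \<epsilon> * Bt t r (-z)) (\<lambda>t r z. \<epsilon> * Br t r (-z)) (\<lambda>t r z. \<epsilon> * - Bz t r (-z))
    (\<lambda>t r z. -1 * C t r (-z)) (\<lambda>t r z. -1 * Ct t r (-z)) (\<lambda>t r z. -1 * Cr t r (-z)) (\<lambda>t r z. -1 * - Cz t r (-z))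
    (\<lambda>t r z. p t r (-z)) (\<lambda>t r z. pr t r (-z)) (\<lambda>t r z. - pz t r (-z))"
proof (unfold_locales, goal_cases)
  case 1 show ?case by (rule C1_trz_reflect[OF A])
next
  case 2 show ?case by (rule C1_trz_scale[OF C1_trz_reflect[OF B]])
next
  case 3 show ?case by (rule C1_trz_scale[OF C1_trz_reflect[OF C]])
next
  case (4 t) then show ?case by (rule C1_rz_reflect[OF p])
next
  \<comment> \<open>Reflection turns a shift forward into a shift backward, so periodicity is used
    from the shifted point.\<close>
  case (5 t r z) then show ?case using periodic[OF 5, of "- z - 2 * pi"] by (simp add: algebra_simps)
next
  case (9 t r z) then show ?case using div[OF 9] by simp
next
  case (10 t r z)
  have "(\<epsilon> * x)\<^sup>2 = x\<^sup>2" for x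
    using assms by (simp add: power_mult_distrib power2_eq_square)
  then show ?case using momentum_r[OF 10, of "-z"] by simp
next
  case (11 t r z)
  have "\<epsilon> * (Bt t r (-z) + A t r (-z) * Br t r (-z) + C t r (-z) * Bz t r (-z) + A t r (-z) * B t r (-z) / r) = 0"
    using momentum_theta[OF 11] by simp
  then show ?case by (simp add: algebra_simps)
next
  case (12 t r z) then show ?case using momentum_z[OF 12, of "-z"] by simp
qed (use axis wall in auto)

end

text \<open>Every advective difference is split as in
  \<open>A * Ar - A' * Ar' = A * (Ar - Ar') + (A - A') * Ar'\<close>: the first parts add up to
  transport of the energy density by \<open>(A, C)\<close>, the second to a quadratic form in the
  differences with coefficients from the primed solution. In the swirl terms \<open>B'\<close>
  cancels, leaving \<open>(A - A') * (B - B') * B - (B - B')\<^sup>2 * A\<close>; these two terms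
  carry no factor \<open>r\<close>.\<close>

lemma energy_identity:
  fixes r :: real
  assumes "r * At = - r * pr - r * A * Ar - r * C * Az + B\<^sup>2" "r * At' = - r * pr' - r * A' * Ar' - r * C' * Az' + B'\<^sup>2"
    "r * Bt = - r * A * Br - r * C * Bz - A * B" "r * Bt' = - r * A' * Br' - r * C' * Bz' - A' * B'"
    "Ct = - pz - A * Cr - C * Cz" "Ct' = - pz' - A' * Cr' - C' * Cz'"
  shows "r * (2 * ((A - A') * (At - At') + (B - B') * (Bt - Bt') + (C - C') * (Ct - Ct')))
    = - (r * (A * (2 * ((A - A') * (Ar - Ar') + (B - B') * (Br - Br') + (C - C') * (Cr - Cr')))
        + C * (2 * ((A - A') * (Az - Az') + (B - B') * (Bz - Bz') + (C - C') * (Cz - Cz')))))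
      - 2 * (r * ((A - A') * (pr - pr') + (C - C') * (pz - pz')))
      - 2 * (r * ((A - A')\<^sup>2 * Ar' + (A - A') * (C - C') * Az' + (A - A') * (B - B') * Br'
        + (B - B') * (C - C') * Bz' + (A - A') * (C - C') * Cr' + (C - C')\<^sup>2 * Cz')
        + (B - B')\<^sup>2 * A - (A - A') * (B - B') * B)"
proof -
  have "r * (2 * ((A - A') * (At - At') + (B - B') * (Bt - Bt') + (C - C') * (Ct - Ct')))
    = 2 * ((A - A') * (r * At - r * At') + (B - B') * (r * Bt - r * Bt') + r * ((C - C') * (Ct - Ct')))"
    by (simp add: algebra_simps)
  then show ?thesis
    unfolding assms by (simp add: algebra_simps power2_eq_square)
qed

text \<open>Energy method for \<open>\<integral> r |w|\<^sup>2\<close>, where \<open>w\<close> is the difference of the two velocities: transport by \<open>(A, C)\<close> and the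
  pressure difference contribute only fluxes.\<close>

lemma meridional_euler_unique:
  assumes "meridional_euler A At Ar Az B Bt Br Bz C Ct Cr Cz p pr pz"
    and "meridional_euler A' At' Ar' Az' B' Bt' Br' Bz' C' Ct' Cr' Cz' p' pr' pz'"
    and init: "\<And>r z. r \<in> {0..1} \<Longrightarrow> z \<in> {-pi..pi} \<Longrightarrow> A 0 r z = A' 0 r z \<and> B 0 r z = B' 0 r z \<and> C 0 r z = C' 0 r z"
    and \<tau>: "0 \<le> \<tau>" and r1: "r1 \<in> {0..1}" and z1: "z1 \<in> {-pi..pi}"
  shows "A \<tau> r1 z1 = A' \<tau> r1 z1 \<and> B \<tau> r1 z1 = B' \<tau> r1 z1 \<and> C \<tau> r1 z1 = C' \<tau> r1 z1"
proof -
  interpret s: meridional_euler A At Ar Az B Bt Br Bz C Ct Cr Cz p pr pz by fact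
  interpret s': meridional_euler A' At' Ar' Az' B' Bt' Br' Bz' C' Ct' Cr' Cz' p' pr' pz' by fact
  define \<alpha> where "\<alpha> t r z = A t r z - A' t r z" for t r z
  define \<alpha>t where "\<alpha>t t r z = At t r z - At' t r z" for t r z
  define \<alpha>r where "\<alpha>r t r z = Ar t r z - Ar' t r z" for t r z
  define \<alpha>z where "\<alpha>z t r z = Az t r z - Az' t r z" for t r z
  define \<beta> where "\<beta> t r z = B t r z - B' t r z" for t r z
  define \<beta>t where "\<beta>t t r z = Bt t r z - Bt' t r z" for t r z
  define \<beta>r where "\<beta>r t r z = Br t r z - Br' t r z" for t r z
  define \<beta>z where "\<beta>z t r z = Bz t r z - Bz' t r z" for t r z
  define \<gamma> where "\<gamma> t r z = C t r z - C' t r z" for t r z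
  define \<gamma>t where "\<gamma>t t r z = Ct t r z - Ct' t r z" for t r z
  define \<gamma>r where "\<gamma>r t r z = Cr t r z - Cr' t r z" for t r z
  define \<gamma>z where "\<gamma>z t r z = Cz t r z - Cz' t r z" for t r z
  define q where "q t r z = p t r z - p' t r z" for t r z
  define qr where "qr t r z = pr t r z - pr' t r z" for t r z
  define qz where "qz t r z = pz t r z - pz' t r z" for t r z
  have \<alpha>: "C1_trz \<alpha> \<alpha>t \<alpha>r \<alpha>z" and \<beta>: "C1_trz \<beta> \<beta>t \<beta>r \<beta>z" and \<gamma>: "C1_trz \<gamma> \<gamma>t \<gamma>r \<gamma>z"
    unfolding \<alpha>_def \<alpha>t_def \<alpha>r_def \<alpha>z_def \<beta>_def \<beta>t_def \<beta>r_def \<beta>z_def \<gamma>_def \<gamma>t_def \<gamma>r_def \<gamma>z_def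
    using C1_trz_diff[OF s.A s'.A] C1_trz_diff[OF s.B s'.B] C1_trz_diff[OF s.C s'.C] by simp_all
  have q: "C1_rz (q t) (qr t) (qz t)" if "0 \<le> t" for t
    unfolding q_def qr_def qz_def by (rule C1_rz_diff[OF s.p[OF that] s'.p[OF that]])
  define e where "e t r z = (\<alpha> t r z)\<^sup>2 + (\<beta> t r z)\<^sup>2 + (\<gamma> t r z)\<^sup>2" for t r z
  define et where "et t r z = 2 * (\<alpha> t r z * \<alpha>t t r z + \<beta> t r z * \<beta>t t r z + \<gamma> t r z * \<gamma>t t r z)" for t r z
  define er where "er t r z = 2 * (\<alpha> t r z * \<alpha>r t r z + \<beta> t r z * \<beta>r t r z + \<gamma> t r z * \<gamma>r t r z)" for t r z
  define ez where "ez t r z = 2 * (\<alpha> t r z * \<alpha>z t r z + \<beta> t r z * \<beta>z t r z + \<gamma> t r z * \<gamma>z t r z)" for t r z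
  have c3: "cont3 \<alpha>" "cont3 \<alpha>t" "cont3 \<alpha>r" "cont3 \<alpha>z" "cont3 \<beta>" "cont3 \<beta>t" "cont3 \<beta>r" "cont3 \<beta>z"
    "cont3 \<gamma>" "cont3 \<gamma>t" "cont3 \<gamma>r" "cont3 \<gamma>z"
    using \<alpha> \<beta> \<gamma> by (auto simp: C1_trz_def)
  have e: "C1_trz e et er ez"
    unfolding C1_trz_def
  proof (intro conjI allI impI ballI)
    show "cont3 e" unfolding e_def by (intro cont3_intros c3)
    show "cont3 et" unfolding et_def by (intro cont3_intros c3)
    show "cont3 er" unfolding er_def by (intro cont3_intros c3)
    show "cont3 ez" unfolding ez_def by (intro cont3_intros c3)
    fix t r z :: real assume *: "0 \<le> t" "r \<in> {0..1}"
    have d: "((\<lambda>s. \<alpha> s r z) has_real_derivative \<alpha>t t r z) (at t within {0..})"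
        "((\<lambda>s. \<beta> s r z) has_real_derivative \<beta>t t r z) (at t within {0..})"
        "((\<lambda>s. \<gamma> s r z) has_real_derivative \<gamma>t t r z) (at t within {0..})"
        "((\<lambda>s. \<alpha> t s z) has_real_derivative \<alpha>r t r z) (at r within {0..1})"
        "((\<lambda>s. \<beta> t s z) has_real_derivative \<beta>r t r z) (at r within {0..1})"
        "((\<lambda>s. \<gamma> t s z) has_real_derivative \<gamma>r t r z) (at r within {0..1})"
        "((\<lambda>s. \<alpha> t r s) has_real_derivative \<alpha>z t r z) (at z)"
        "((\<lambda>s. \<beta> t r s) has_real_derivative \<beta>z t r z) (at z)"
        "((\<lambda>s. \<gamma> t r s) has_real_derivative \<gamma>z t r z) (at z)"
      using \<alpha> \<beta> \<gamma> * by (auto simp: C1_trz_def)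
    show "((\<lambda>s. e s r z) has_real_derivative et t r z) (at t within {0..})"
      unfolding e_def et_def by (rule derivative_eq_intros d refl | simp add: algebra_simps)+
    show "((\<lambda>s. e t s z) has_real_derivative er t r z) (at r within {0..1})"
      unfolding e_def er_def by (rule derivative_eq_intros d refl | simp add: algebra_simps)+
    show "((\<lambda>s. e t r s) has_real_derivative ez t r z) (at z)"
      unfolding e_def ez_def by (rule derivative_eq_intros d refl | simp add: algebra_simps)+
  qed
  let ?Q = "cbox (0, -pi) (1, pi) :: (real \<times> real) set"
  have cQ: "continuous_on ?Q (\<lambda>(r, z). g t r z)" if "cont3 g" "0 \<le> t" for g t
    using cont3_imp_cont2[OF that] unfolding cont2_def by (rule continuous_on_subset) auto
  have cre: "cont3 (\<lambda>t r z. r * e t r z)" and cret: "cont3 (\<lambda>t r z. r * et t r z)"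
    using e by (auto simp: C1_trz_def intro!: cont3_intros)
  define E where "E t = integral ?Q (\<lambda>(r, z). r * e t r z)" for t
  define E' where "E' t = integral ?Q (\<lambda>(r, z). r * et t r z)" for t
  have derivE: "(E has_real_derivative E' t) (at t within {0..})" if t: "0 \<le> t" for t
    unfolding E_def E'_def
  proof (rule leibniz_rule_field_derivative[where fx = "\<lambda>t (r, z). r * et t r z"])
    show "continuous_on ({0..} \<times> ?Q) (\<lambda>(t, r, z). r * et t r z)"
      using cret unfolding cont3_def by (rule continuous_on_subset) auto
    show "(\<lambda>(r, z). r * e t r z) integrable_on ?Q" if "t \<in> {0..}" for t
      using that by (intro integrable_continuous cQ[OF cre]) auto
    fix t x assume "t \<in> {0::real..}" "x \<in> ?Q"
    then show "((\<lambda>t. case x of (r, z) \<Rightarrow> r * e t r z) has_real_derivative (case x of (r, z) \<Rightarrow> r * et t r z))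
        (at t within {0..})"
      using e by (cases x) (auto simp: C1_trz_def intro!: DERIV_cmult)
  qed (use t in auto)

  obtain M1 where M1: "\<And>t r z. 0 \<le> t \<Longrightarrow> t \<le> \<tau> \<Longrightarrow> r \<in> {0..1} \<Longrightarrow> z \<in> {-pi..pi} \<Longrightarrow> \<bar>Ar t r z\<bar> \<le> M1"
    using s.A cont3_bounded[of Ar \<tau>] by (auto simp: C1_trz_def)
  obtain M2 where M2: "\<And>t r z. 0 \<le> t \<Longrightarrow> t \<le> \<tau> \<Longrightarrow> r \<in> {0..1} \<Longrightarrow> z \<in> {-pi..pi} \<Longrightarrow> \<bar>Br t r z\<bar> \<le> M2"
    using s.B cont3_bounded[of Br \<tau>] by (auto simp: C1_trz_def)
  \<comment> \<open>One compactness argument for the sum of squares bounds all six derivatives;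
    \<open>|x| \<le> 1 + x\<^sup>2\<close> returns to absolute values, which explains
    \<open>1 + M3\<close> in \<open>M\<close>.\<close>
  have "cont3 (\<lambda>t r z. (Ar' t r z)\<^sup>2 + (Az' t r z)\<^sup>2 + (Br' t r z)\<^sup>2 + (Bz' t r z)\<^sup>2 + (Cr' t r z)\<^sup>2 + (Cz' t r z)\<^sup>2)"
    using s'.A s'.B s'.C by (auto simp: C1_trz_def intro!: cont3_intros)
  then obtain M3 where M3: "\<And>t r z. 0 \<le> t \<Longrightarrow> t \<le> \<tau> \<Longrightarrow> r \<in> {0..1} \<Longrightarrow> z \<in> {-pi..pi} \<Longrightarrow>
      \<bar>(Ar' t r z)\<^sup>2 + (Az' t r z)\<^sup>2 + (Br' t r z)\<^sup>2 + (Bz' t r z)\<^sup>2 + (Cr' t r z)\<^sup>2 + (Cz' t r z)\<^sup>2\<bar> \<le> M3"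
    by (rule cont3_bounded[where \<tau> = \<tau>]) (rule that)
  define M where "M = max (max M1 M2) (1 + M3)"
  have le1: "\<bar>x\<bar> \<le> 1 + S" if "x\<^sup>2 \<le> S" for x S :: real
  proof -
    have "0 \<le> (\<bar>x\<bar> - 1)\<^sup>2" by simp
    then have "\<bar>x\<bar> \<le> 1 + x\<^sup>2" by (simp add: power2_eq_square algebra_simps)
    then show ?thesis using that by simp
  qed
  have Mbd: "\<bar>Ar' t r z\<bar> \<le> M" "\<bar>Az' t r z\<bar> \<le> M" "\<bar>Br' t r z\<bar> \<le> M" "\<bar>Bz' t r z\<bar> \<le> M" "\<bar>Cr' t r z\<bar> \<le> M" "\<bar>Cz' t r z\<bar> \<le> M"
      "\<bar>A t r z\<bar> \<le> M * r" "\<bar>B t r z\<bar> \<le> M * r"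
    if t: "0 \<le> t" "t \<le> \<tau>" "r \<in> {0..1}" "z \<in> {-pi..pi}" for t r z
  proof -
    have "0 \<le> (Ar' t r z)\<^sup>2" "0 \<le> (Az' t r z)\<^sup>2" "0 \<le> (Br' t r z)\<^sup>2" "0 \<le> (Bz' t r z)\<^sup>2"
      "0 \<le> (Cr' t r z)\<^sup>2" "0 \<le> (Cz' t r z)\<^sup>2" by simp_all
    with M3[OF t] have sq: "(Ar' t r z)\<^sup>2 \<le> M3" "(Az' t r z)\<^sup>2 \<le> M3" "(Br' t r z)\<^sup>2 \<le> M3"
      "(Bz' t r z)\<^sup>2 \<le> M3" "(Cr' t r z)\<^sup>2 \<le> M3" "(Cz' t r z)\<^sup>2 \<le> M3" by linarith+
    have "1 + M3 \<le> M" by (simp add: M_def)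
    then show "\<bar>Ar' t r z\<bar> \<le> M" "\<bar>Az' t r z\<bar> \<le> M" "\<bar>Br' t r z\<bar> \<le> M" "\<bar>Bz' t r z\<bar> \<le> M"
      "\<bar>Cr' t r z\<bar> \<le> M" "\<bar>Cz' t r z\<bar> \<le> M"
      using sq[THEN le1] by linarith+
    have "\<bar>A t r z\<bar> \<le> M1 * r" by (rule vanishing_on_axis_bound[OF s.A s.axis(1) M1 t])
    also have "\<dots> \<le> M * r" using t by (intro mult_right_mono) (auto simp: M_def)
    finally show "\<bar>A t r z\<bar> \<le> M * r" .
    have "\<bar>B t r z\<bar> \<le> M2 * r" by (rule vanishing_on_axis_bound[OF s.B s.axis(2) M2 t])
    also have "\<dots> \<le> M * r" using t by (intro mult_right_mono) (auto simp: M_def)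
    finally show "\<bar>B t r z\<bar> \<le> M * r" .
  qed
  have bil: "- (x * y * w) \<le> m / 2 * S" if "\<bar>w\<bar> \<le> m" "x\<^sup>2 + y\<^sup>2 \<le> S" for x y w m S :: real
  proof -
    have "2 * \<bar>x * y\<bar> \<le> x\<^sup>2 + y\<^sup>2"
      using sum_squares_bound[of "\<bar>x\<bar>" "\<bar>y\<bar>"] by (simp add: abs_mult)
    then have S: "\<bar>x * y\<bar> \<le> S / 2" using that(2) by linarith
    have "- (x * y * w) \<le> \<bar>w\<bar> * \<bar>x * y\<bar>" by (metis abs_ge_minus_self abs_mult mult.commute)
    also have "\<dots> \<le> m * (S / 2)" using that(1) S by (intro mult_mono) auto
    finally show ?thesis by simp
  qed
  \<comment> \<open>The part of the energy balance that is not a flux.\<close>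
  define R where "R t r z = r * ((\<alpha> t r z)\<^sup>2 * Ar' t r z + \<alpha> t r z * \<gamma> t r z * Az' t r z + \<alpha> t r z * \<beta> t r z * Br' t r z
      + \<beta> t r z * \<gamma> t r z * Bz' t r z + \<alpha> t r z * \<gamma> t r z * Cr' t r z + (\<gamma> t r z)\<^sup>2 * Cz' t r z)
      + (\<beta> t r z)\<^sup>2 * A t r z - \<alpha> t r z * \<beta> t r z * B t r z" for t r z
  have energy: "r * et t r z = - (r * (A t r z * er t r z + C t r z * ez t r z))
      - 2 * (r * (\<alpha> t r z * qr t r z + \<gamma> t r z * qz t r z)) - 2 * R t r z"
    if t: "0 \<le> t" and r: "r \<in> {0..1}" for t r z
  proof (cases "r = 0")
    case True
    \<comment> \<open>On the axis every weighted term is 0, and the two unweighted terms of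
      \<open>R\<close> contain \<open>A\<close> or \<open>B\<close>.\<close>
    then show ?thesis using s.axis[OF t] by (simp add: R_def)
  next
    case False
    have clear: "r * x = r * y + w" if "x = y + w / r" for x y w
      using False that by (simp add: distrib_left)
    have "r * At t r z = r * (- pr t r z - A t r z * Ar t r z - C t r z * Az t r z) + (B t r z)\<^sup>2"
      "r * At' t r z = r * (- pr' t r z - A' t r z * Ar' t r z - C' t r z * Az' t r z) + (B' t r z)\<^sup>2"
      using s.momentum_r[OF t r, of z] s'.momentum_r[OF t r, of z] by (intro clear; simp)+
    then have 1: "r * At t r z = - r * pr t r z - r * A t r z * Ar t r z - r * C t r z * Az t r z + (B t r z)\<^sup>2"
      "r * At' t r z = - r * pr' t r z - r * A' t r z * Ar' t r z - r * C' t r z * Az' t r z + (B' t r z)\<^sup>2"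
      by (simp_all add: algebra_simps)
    have "r * Bt t r z = r * (- A t r z * Br t r z - C t r z * Bz t r z) + - A t r z * B t r z"
      "r * Bt' t r z = r * (- A' t r z * Br' t r z - C' t r z * Bz' t r z) + - A' t r z * B' t r z"
      using s.momentum_theta[OF t r, of z] s'.momentum_theta[OF t r, of z] by (intro clear; simp)+
    then have 2: "r * Bt t r z = - r * A t r z * Br t r z - r * C t r z * Bz t r z - A t r z * B t r z"
      "r * Bt' t r z = - r * A' t r z * Br' t r z - r * C' t r z * Bz' t r z - A' t r z * B' t r z"
      by (simp_all add: algebra_simps)
    have 3: "Ct t r z = - pz t r z - A t r z * Cr t r z - C t r z * Cz t r z"
      "Ct' t r z = - pz' t r z - A' t r z * Cr' t r z - C' t r z * Cz' t r z"
      using s.momentum_z[OF t r, of z] s'.momentum_z[OF t r, of z] by simp_all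
    show ?thesis
      unfolding et_def er_def ez_def R_def \<alpha>t_def \<beta>t_def \<gamma>t_def \<alpha>_def \<alpha>r_def \<alpha>z_def \<beta>_def \<beta>r_def \<beta>z_def
        \<gamma>_def \<gamma>r_def \<gamma>z_def qr_def qz_def
      by (rule energy_identity[OF 1 2 3])
  qed
  \<comment> \<open>In units of \<open>M * r * e\<close>: the two squares cost 1 each and the four
    mixed products 1/2 each, together 4; the term with \<open>A\<close> costs 1 and the term with
    \<open>B\<close> costs 1/2, because \<open>A\<close> and \<open>B\<close> are at most
    \<open>M * r\<close> in absolute value. Twice 11/2 is 11.\<close>
  have R: "- 2 * R t r z \<le> 11 * M * (r * e t r z)"
    if t: "0 \<le> t" "t \<le> \<tau>" "r \<in> {0..1}" "z \<in> {-pi..pi}" for t r z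
  proof -
    note m = Mbd[OF t]
    define S where "S = e t r z"
    have sq: "(\<alpha> t r z)\<^sup>2 + (\<alpha> t r z)\<^sup>2 \<le> 2 * S" "(\<beta> t r z)\<^sup>2 + (\<beta> t r z)\<^sup>2 \<le> 2 * S"
      "(\<gamma> t r z)\<^sup>2 + (\<gamma> t r z)\<^sup>2 \<le> 2 * S" "(\<alpha> t r z)\<^sup>2 + (\<beta> t r z)\<^sup>2 \<le> S"
      "(\<alpha> t r z)\<^sup>2 + (\<gamma> t r z)\<^sup>2 \<le> S" "(\<beta> t r z)\<^sup>2 + (\<gamma> t r z)\<^sup>2 \<le> S"
      by (simp_all add: S_def e_def)
    have mB: "\<bar>- B t r z\<bar> \<le> M * r" using m(8) by simp
    have b: "- (\<alpha> t r z * \<alpha> t r z * Ar' t r z) \<le> M / 2 * (2 * S)"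
      "- (\<alpha> t r z * \<gamma> t r z * Az' t r z) \<le> M / 2 * S"
      "- (\<alpha> t r z * \<beta> t r z * Br' t r z) \<le> M / 2 * S"
      "- (\<beta> t r z * \<gamma> t r z * Bz' t r z) \<le> M / 2 * S"
      "- (\<alpha> t r z * \<gamma> t r z * Cr' t r z) \<le> M / 2 * S"
      "- (\<gamma> t r z * \<gamma> t r z * Cz' t r z) \<le> M / 2 * (2 * S)"
      "- (\<beta> t r z * \<beta> t r z * A t r z) \<le> M * r / 2 * (2 * S)"
      "- (\<alpha> t r z * \<beta> t r z * - B t r z) \<le> M * r / 2 * S"
      by (rule bil; fact m sq mB)+
    define V where "V = - ((\<alpha> t r z)\<^sup>2 * Ar' t r z + \<alpha> t r z * \<gamma> t r z * Az' t r z + \<alpha> t r z * \<beta> t r z * Br' t r z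
      + \<beta> t r z * \<gamma> t r z * Bz' t r z + \<alpha> t r z * \<gamma> t r z * Cr' t r z + (\<gamma> t r z)\<^sup>2 * Cz' t r z)"
    have "V \<le> 4 * (M * S)"
      using b(1-6) by (simp add: power2_eq_square V_def)
    then have "r * V \<le> r * (4 * (M * S))" using t by (intro mult_left_mono) auto
    moreover have "- R t r z = r * V - (\<beta> t r z * \<beta> t r z * A t r z) - (\<alpha> t r z * \<beta> t r z * - B t r z)"
      by (simp add: R_def V_def algebra_simps power2_eq_square)
    moreover have "M * r / 2 * (2 * S) = r * (M * S)" "M * r / 2 * S = r * (M * S) / 2" by simp_all
    ultimately have "- R t r z \<le> 4 * (r * (M * S)) + r * (M * S) + r * (M * S) / 2"
      using b(7,8) by linarith
    then show ?thesis by (simp add: S_def)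
  qed
  have boundE: "E' t \<le> 11 * M * E t" if t: "0 \<le> t" "t \<le> \<tau>" for t
  proof -
    have 1: "((\<lambda>(r, z). r * (A t r z * er t r z + C t r z * ez t r z)) has_integral 0) ?Q"
    proof (rule integral_transport_eq_0)
      show "e t r pi = e t r (-pi)" if "r \<in> {0..1}" for r
        using s.periodic_pi[OF t(1) that] s'.periodic_pi[OF t(1) that]
        by (simp add: e_def \<alpha>_def \<beta>_def \<gamma>_def)
    qed (fact C1_trz_imp_C1_rz[OF e t(1)] C1_trz_imp_C1_rz[OF s.A t(1)] C1_trz_imp_C1_rz[OF s.C t(1)]
        s.div[OF t(1)] s.wall[OF t(1)] s.periodic_pi[OF t(1)])+
    \<comment> \<open>The difference of the velocities is itself divergence free and tangent to the
      wall, so the work of the pressure difference is a flux and no bound on \<open>q\<close>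
      enters.\<close>
    have 2: "((\<lambda>(r, z). r * (\<alpha> t r z * qr t r z + \<gamma> t r z * qz t r z)) has_integral 0) ?Q"
    proof (rule integral_transport_eq_0)
      show "q t r pi = q t r (-pi)" "\<gamma> t r pi = \<gamma> t r (-pi)" if "r \<in> {0..1}" for r
        using s.periodic_pi[OF t(1) that] s'.periodic_pi[OF t(1) that]
        by (simp_all add: q_def \<gamma>_def)
      show "r * \<alpha>r t r z + \<alpha> t r z + r * \<gamma>z t r z = 0" if "r \<in> {0..1}" for r z
        using s.div[OF t(1) that, of z] s'.div[OF t(1) that, of z]
        by (simp add: \<alpha>_def \<alpha>r_def \<gamma>z_def algebra_simps)
      show "\<alpha> t 1 z = 0" for z using s.wall[OF t(1)] s'.wall[OF t(1)] by (simp add: \<alpha>_def)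
    qed (fact q[OF t(1)] C1_trz_imp_C1_rz[OF \<alpha> t(1)] C1_trz_imp_C1_rz[OF \<gamma> t(1)])+
    have 3: "((\<lambda>(r, z). r * e t r z) has_integral E t) ?Q"
      unfolding E_def by (intro integrable_integral integrable_continuous cQ[OF cre t(1)])
    have 4: "((\<lambda>(r, z). r * et t r z) has_integral E' t) ?Q"
      unfolding E'_def by (intro integrable_integral integrable_continuous cQ[OF cret t(1)])
    have 5: "((\<lambda>x. - (case x of (r, z) \<Rightarrow> r * (A t r z * er t r z + C t r z * ez t r z))
        - 2 * (case x of (r, z) \<Rightarrow> r * (\<alpha> t r z * qr t r z + \<gamma> t r z * qz t r z))
        + (11 * M) * (case x of (r, z) \<Rightarrow> r * e t r z)) has_integral - 0 - 2 * 0 + (11 * M) * E t) ?Q"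
      by (intro has_integral_add has_integral_diff has_integral_neg has_integral_mult_right 1 2 3)
    have "E' t \<le> - 0 - 2 * 0 + (11 * M) * E t"
    proof (rule has_integral_le[OF 4 5])
      fix x assume "x \<in> ?Q"
      then obtain r z where x: "x = (r, z)" "r \<in> {0..1}" "z \<in> {-pi..pi}" by (cases x) auto
      show "(case x of (r, z) \<Rightarrow> r * et t r z) \<le>
        - (case x of (r, z) \<Rightarrow> r * (A t r z * er t r z + C t r z * ez t r z))
        - 2 * (case x of (r, z) \<Rightarrow> r * (\<alpha> t r z * qr t r z + \<gamma> t r z * qz t r z))
        + (11 * M) * (case x of (r, z) \<Rightarrow> r * e t r z)"
        using energy[OF t(1) x(2), of z] R[OF t x(2,3)] by (simp add: x(1))
    qed
    then show ?thesis by simp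
  qed
  have "E 0 = integral ?Q (\<lambda>x. 0)"
    unfolding E_def
    by (rule integral_cong) (auto simp: e_def \<alpha>_def \<beta>_def \<gamma>_def init)
  then have "E \<tau> \<le> 0"
    by (intro gronwall_zero[OF derivE boundE]) (use \<tau> in auto)
  moreover have nonneg: "0 \<le> (case x of (r, z) \<Rightarrow> r * e \<tau> r z)" if "x \<in> ?Q" for x
    using that by (cases x) (auto simp: e_def)
  then have "0 \<le> E \<tau>"
    unfolding E_def by (intro integral_nonneg integrable_continuous cQ[OF cre \<tau>]) auto
  ultimately have "E \<tau> = 0" by simp
  then have int0: "((\<lambda>(r, z). r * e \<tau> r z) has_integral 0) ?Q"
    using integrable_integral[OF integrable_continuous[OF cQ[OF cre \<tau>]]] by (simp add: E_def)
  \<comment> \<open>The nonnegative continuous integrand with integral 0 vanishes on the whole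
    closed box; dividing by the weight is possible off the axis only, and continuity in
    \<open>r\<close> then reaches \<open>r = 0\<close>.\<close>
  have e0: "e \<tau> r z1 = 0" if r: "r \<in> {0<..1}" for r
  proof -
    have "(case (r, z1) of (r, z) \<Rightarrow> r * e \<tau> r z) = 0"
    proof (rule has_integral_0_cbox_imp_0[OF cQ[OF cre \<tau>] _ int0])
      show "(r, z1) \<in> ?Q" using r z1 by simp
      show "box (0, -pi) (1, pi) \<noteq> ({} :: (real \<times> real) set)" by (simp add: box_ne_empty Basis_prod_def)
    qed (rule nonneg[OF subsetD[OF box_subset_cbox]])
    then show ?thesis using r by simp
  qed
  have "e \<tau> r1 z1 = 0"
  proof (rule continuous_constant_on_closure[where S = "{0<..1}" and f = "\<lambda>r. e \<tau> r z1"])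
    have "continuous_on {0..1} (\<lambda>r. e \<tau> r z1)"
      using e \<tau> by (intro cont3_compose[where \<phi> = "\<lambda>r. (\<tau>, r, z1)", simplified])
        (auto simp: C1_trz_def intro!: continuous_intros)
    then show "continuous_on (closure {0<..1}) (\<lambda>r. e \<tau> r z1)" by simp
  qed (use e0 r1 in auto)
  then show ?thesis
    by (simp add: e_def \<alpha>_def \<beta>_def \<gamma>_def add_nonneg_eq_0_iff)
qed

section \<open>Reduction of the Euler equation to the half plane\<close>

lemma Ck_on_imp_continuous_on: "Ck_on k S f \<Longrightarrow> continuous_on S f"
  by (cases k) (auto intro: has_derivative_continuous_on)

text \<open>Spatial derivatives are taken within the closed cylinder; curves that stay inside it
  turn them into derivatives of one real variable, one-sided where the curve ends.\<close>

lemma has_vector_derivative_along_curve: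
  assumes f: "(f has_derivative D) (at x within S)"
    and \<gamma>: "(\<gamma> has_vector_derivative v) (at s within J)" "\<gamma> s = x" "\<gamma> ` J \<subseteq> S"
  shows "((\<lambda>s. f (\<gamma> s)) has_vector_derivative D v) (at s within J)"
  using vector_derivative_diff_chain_within[OF \<gamma>(1) has_derivative_subset[OF f[folded \<gamma>(2)] \<gamma>(3)]]
  by (simp add: o_def)

lemma has_vector_derivative_vec_nth:
  "(f has_vector_derivative v) F \<Longrightarrow> ((\<lambda>s. f s $ i) has_real_derivative v $ i) F"
  unfolding has_real_derivative_iff_has_vector_derivative
  by (rule bounded_linear.has_vector_derivative[OF bounded_linear_vec_nth])

section \<open>Derivatives in cylindrical coordinates along the half plane
  \<open>\<theta> = 0\<close>\<close>

lemma cyl_eq: "cyl r \<theta> z = (r * cos \<theta>) *\<^sub>R axis 1 1 + (r * sin \<theta>) *\<^sub>R axis 2 1 + z *\<^sub>R axis 3 1"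
  by (simp add: cyl_def vec_eq_iff forall_3 axis_def)

lemma cyl_nth [simp]: "cyl r \<theta> z $ 1 = r * cos \<theta>" "cyl r \<theta> z $ 2 = r * sin \<theta>" "cyl r \<theta> z $ 3 = z"
  by (simp_all add: cyl_def)

lemma cyl_in_cylinder: "r \<in> {0..1} \<Longrightarrow> cyl r \<theta> z \<in> cylinder"
  by (simp add: cylinder_def power_mult_distrib power_le_one flip: distrib_left)

lemma cyl_periodic: "cyl r \<theta> (z + 2 * pi) = cyl r \<theta> z + vector [0, 0, 2 * pi]"
  by (simp add: cyl_def vec_eq_iff forall_3)

lemma cyl_derivs:
  "((\<lambda>r. cyl r 0 z) has_vector_derivative axis 1 1) F"
  "((\<lambda>z. cyl r 0 z) has_vector_derivative axis 3 1) F"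
  "((\<lambda>\<theta>. cyl r \<theta> z) has_vector_derivative r *\<^sub>R axis 2 1) (at 0)"
  unfolding cyl_eq has_vector_derivative_def by (auto intro!: derivative_eq_intros simp: algebra_simps)

lemma continuous_on_cyl [continuous_intros]:
  "continuous_on S f \<Longrightarrow> continuous_on S g \<Longrightarrow> continuous_on S (\<lambda>x. cyl (f x) 0 (g x))"
  unfolding cyl_eq by (auto intro!: continuous_intros)

lemma C1_rz_cong:
  assumes "C1_rz f fr fz"
    and eq: "\<And>r z. r \<in> {0..1} \<Longrightarrow> f r z = g r z \<and> fr r z = gr r z \<and> fz r z = gz r z"
  shows "C1_rz g gr gz"
proof -
  have c: "cont2 h" if "cont2 k" "\<And>r z. r \<in> {0..1} \<Longrightarrow> k r z = h r z" for h k
    using that(1) unfolding cont2_def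
    by (rule continuous_on_eq) (use that(2) in auto)
  show ?thesis
    unfolding C1_rz_def
  proof (intro conjI ballI allI)
    show "cont2 g" "cont2 gr" "cont2 gz"
      by (rule c[of f] c[of fr] c[of fz]; use assms(1) eq in \<open>simp add: C1_rz_def\<close>)+
    fix r z :: real assume r: "r \<in> {0..1}"
    have f: "((\<lambda>s. f s z) has_real_derivative fr r z) (at r within {0..1})"
      "((\<lambda>s. f r s) has_real_derivative fz r z) (at z)"
      using assms(1) r by (auto simp: C1_rz_def)
    have "((\<lambda>s. g s z) has_real_derivative fr r z) (at r within {0..1})"
      by (rule has_field_derivative_transform_within[OF f(1) zero_less_one r]) (use eq in blast)
    moreover have "f r = g r" using eq[OF r] by auto
    ultimately show "((\<lambda>s. g s z) has_real_derivative gr r z) (at r within {0..1})"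
      "((\<lambda>s. g r s) has_real_derivative gz r z) (at z)"
      using f eq[OF r, of z] by simp_all
  qed
qed

lemma at_within_unit_neq_bot: "r \<in> {0..1} \<Longrightarrow> at r within {0..1::real} \<noteq> bot"
  using at_within_convex_neq_bot[of "{0..1}" r 0] at_within_convex_neq_bot[of "{0..1}" r 1]
  by (cases "r = 0") auto

lemma at_within_halfline_neq_bot: "0 \<le> t \<Longrightarrow> at t within {0..} \<noteq> (bot :: real filter)"
  using at_within_convex_neq_bot[of "{0..}" t "t + 1"] by auto

lemma derivative_in_cylinder:
  assumes D: "(f has_derivative D) (at (cyl r 0 z) within cylinder)" and r: "r \<in> {0..1}"
  shows "((\<lambda>s. f (cyl s 0 z)) has_vector_derivative D (axis 1 1)) (at r within {0..1})"
    and "((\<lambda>s. f (cyl r 0 s)) has_vector_derivative D (axis 3 1)) (at z)"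
    and "((\<lambda>\<theta>. f (cyl r \<theta> z)) has_vector_derivative r *\<^sub>R D (axis 2 1)) (at 0)"
proof -
  show "((\<lambda>s. f (cyl s 0 z)) has_vector_derivative D (axis 1 1)) (at r within {0..1})"
    by (rule has_vector_derivative_along_curve[OF D]) (auto intro!: cyl_derivs cyl_in_cylinder)
  show "((\<lambda>s. f (cyl r 0 s)) has_vector_derivative D (axis 3 1)) (at z)"
    by (rule has_vector_derivative_along_curve[OF D]) (use r in \<open>auto intro!: cyl_derivs cyl_in_cylinder\<close>)
  have "((\<lambda>\<theta>. f (cyl r \<theta> z)) has_vector_derivative D (r *\<^sub>R axis 2 1)) (at 0)"
    by (rule has_vector_derivative_along_curve[OF D]) (use r in \<open>auto intro!: cyl_derivs cyl_in_cylinder\<close>)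
  then show "((\<lambda>\<theta>. f (cyl r \<theta> z)) has_vector_derivative r *\<^sub>R D (axis 2 1)) (at 0)"
    by (simp add: linear_cmul[OF has_derivative_linear[OF D]])
qed

text \<open>At \<open>\<theta> = 0\<close> the first Cartesian axis is the radial direction, so the
  witnesses are the derivative of \<open>F\<close> in the directions \<open>(1, 0)\<close>,
  \<open>(0, axis 1 1)\<close> and \<open>(0, axis 3 1)\<close>. They are kept as functions on
  space-time of class \<open>Ck_on k\<close>, so that the lemma applies to them again and yields
  second derivatives.\<close>

lemma Ck_on_spacetime_partials:
  fixes F :: "real \<times> (real ^ 3) \<Rightarrow> real ^ 3"
  assumes "Ck_on (Suc k) ({0..} \<times> cylinder) F"
  obtains Ft Fr Fz where "Ck_on k ({0..} \<times> cylinder) Ft" "Ck_on k ({0..} \<times> cylinder) Fr" "Ck_on k ({0..} \<times> cylinder) Fz"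
    "\<And>i. C1_trz (\<lambda>t r z. F (t, cyl r 0 z) $ i) (\<lambda>t r z. Ft (t, cyl r 0 z) $ i)
      (\<lambda>t r z. Fr (t, cyl r 0 z) $ i) (\<lambda>t r z. Fz (t, cyl r 0 z) $ i)"
    "\<And>t r z. 0 \<le> t \<Longrightarrow> r \<in> {0..1} \<Longrightarrow>
      ((\<lambda>s. F (s, cyl r 0 z)) has_vector_derivative Ft (t, cyl r 0 z)) (at t within {0..})"
proof -
  let ?S = "{0..} \<times> cylinder :: (real \<times> (real ^ 3)) set"
  obtain F' where F': "\<And>x. x \<in> ?S \<Longrightarrow> (F has_derivative F' x) (at x within ?S)"
    and k: "\<And>v. Ck_on k ?S (\<lambda>x. F' x v)"
    using assms by auto
  have dt: "((\<lambda>s. F (s, cyl r 0 z)) has_vector_derivative F' (t, cyl r 0 z) (1, 0)) (at t within {0..})"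
    if "0 \<le> t" "r \<in> {0..1}" for t r z
    by (rule has_vector_derivative_along_curve[OF F'])
       (use that in \<open>auto intro!: derivative_eq_intros cyl_in_cylinder\<close>)
  have dr: "((\<lambda>s. F (t, cyl s 0 z)) has_vector_derivative F' (t, cyl r 0 z) (0, axis 1 1)) (at r within {0..1})"
    if "0 \<le> t" "r \<in> {0..1}" for t r z
    by (rule has_vector_derivative_along_curve[OF F'])
       (use that in \<open>auto intro!: has_vector_derivative_Pair derivative_intros cyl_derivs cyl_in_cylinder\<close>)
  have dz: "((\<lambda>s. F (t, cyl r 0 s)) has_vector_derivative F' (t, cyl r 0 z) (0, axis 3 1)) (at z)"
    if "0 \<le> t" "r \<in> {0..1}" for t r z
    by (rule has_vector_derivative_along_curve[OF F'])
       (use that in \<open>auto intro!: has_vector_derivative_Pair derivative_intros cyl_derivs cyl_in_cylinder\<close>)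
  have c: "cont3 (\<lambda>t r z. G (t, cyl r 0 z) $ i)" if "Ck_on j ?S G" for j i and G :: "real \<times> (real ^ 3) \<Rightarrow> real ^ 3"
    unfolding cont3_def split_def
    by (intro continuous_on_component continuous_on_compose2[OF Ck_on_imp_continuous_on[OF that]] continuous_intros)
       (auto intro: cyl_in_cylinder)
  show thesis
  proof (rule that[OF k k k _ dt])
    show "C1_trz (\<lambda>t r z. F (t, cyl r 0 z) $ i) (\<lambda>t r z. F' (t, cyl r 0 z) (1, 0) $ i)
      (\<lambda>t r z. F' (t, cyl r 0 z) (0, axis 1 1) $ i) (\<lambda>t r z. F' (t, cyl r 0 z) (0, axis 3 1) $ i)" for i
      unfolding C1_trz_def using c[OF assms] c[OF k] dt dr dz
      by (auto intro!: has_vector_derivative_vec_nth)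
  qed auto
qed

text \<open>\<open>gradient\<close> uses the chosen \<open>frechet_derivative\<close>, while
  \<open>Ck_on\<close> supplies some derivative. Both are read off along the radial and the axial
  line, where one-dimensional derivatives are unique, so their components 1 and 3 agree.\<close>

lemma Ck_on_gradient:
  fixes f :: "real ^ 3 \<Rightarrow> real"
  assumes "Ck_on (Suc k) cylinder f"
  obtains fr fz where "Ck_on k cylinder fr" "Ck_on k cylinder fz"
    "C1_rz (\<lambda>r z. f (cyl r 0 z)) (\<lambda>r z. fr (cyl r 0 z)) (\<lambda>r z. fz (cyl r 0 z))"
    "\<And>r z. r \<in> {0..1} \<Longrightarrow> gradient f (cyl r 0 z) $ 1 = fr (cyl r 0 z)"
    "\<And>r z. r \<in> {0..1} \<Longrightarrow> gradient f (cyl r 0 z) $ 3 = fz (cyl r 0 z)"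
proof -
  obtain f' where f': "\<And>x. x \<in> cylinder \<Longrightarrow> (f has_derivative f' x) (at x within cylinder)"
    and k: "\<And>v. Ck_on k cylinder (\<lambda>x. f' x v)"
    using assms by auto
  have c: "cont2 (\<lambda>r z. g (cyl r 0 z))" if "Ck_on j cylinder g" for j and g :: "real ^ 3 \<Rightarrow> real"
    unfolding cont2_def split_def
    by (intro continuous_on_compose2[OF Ck_on_imp_continuous_on[OF that]] continuous_intros)
       (auto intro: cyl_in_cylinder)
  show thesis
  proof (rule that[OF k k])
    show "C1_rz (\<lambda>r z. f (cyl r 0 z)) (\<lambda>r z. f' (cyl r 0 z) (axis 1 1)) (\<lambda>r z. f' (cyl r 0 z) (axis 3 1))"
      unfolding C1_rz_def has_real_derivative_iff_has_vector_derivative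
      using c[OF assms] c[OF k] derivative_in_cylinder[OF f'[OF cyl_in_cylinder]] by auto
    fix r z :: real assume r: "r \<in> {0..1}"
    have D: "(f has_derivative frechet_derivative f (at (cyl r 0 z) within cylinder)) (at (cyl r 0 z) within cylinder)"
      using f'[OF cyl_in_cylinder[OF r]] frechet_derivative_works differentiableI by blast
    show "gradient f (cyl r 0 z) $ 1 = f' (cyl r 0 z) (axis 1 1)"
      using vector_derivative_unique_within[OF at_within_unit_neq_bot[OF r]
          derivative_in_cylinder(1)[OF D r] derivative_in_cylinder(1)[OF f'[OF cyl_in_cylinder[OF r]] r]]
      by (simp add: gradient_def)
    show "gradient f (cyl r 0 z) $ 3 = f' (cyl r 0 z) (axis 3 1)"
      using vector_derivative_unique_at[OF
          derivative_in_cylinder(2)[OF D r] derivative_in_cylinder(2)[OF f'[OF cyl_in_cylinder[OF r]] r]]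
      by (simp add: gradient_def)
  qed
qed

lemma axisymmetric_gradient_theta:
  assumes "axisymmetric_scalar f p" "f differentiable (at (cyl r 0 z) within cylinder)" "r \<in> {0<..1}"
  shows "gradient f (cyl r 0 z) $ 2 = 0"
proof -
  have r: "r \<in> {0..1}" using assms(3) by simp
  have "((\<lambda>\<theta>. f (cyl r \<theta> z)) has_vector_derivative
      r *\<^sub>R frechet_derivative f (at (cyl r 0 z) within cylinder) (axis 2 1)) (at 0)"
    using assms(2) r by (intro derivative_in_cylinder(3)) (simp_all add: frechet_derivative_works)
  moreover have "((\<lambda>\<theta>. f (cyl r \<theta> z)) has_vector_derivative 0) (at 0)"
    using assms(1) r by (simp add: axisymmetric_scalar_def)
  ultimately have "r *\<^sub>R frechet_derivative f (at (cyl r 0 z) within cylinder) (axis 2 1) = 0"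
    by (rule vector_derivative_unique_at)
  then show ?thesis using assms(3) by (simp add: gradient_def)
qed

lemma axisymmetric_fieldD:
  assumes "axisymmetric_field V a b c" "r \<in> {0..1}"
  shows "a r z = V (cyl r 0 z) $ 1" "b r z = V (cyl r 0 z) $ 2" "c r z = V (cyl r 0 z) $ 3"
    and "V (cyl 0 0 z) $ 1 = 0" "V (cyl 0 0 z) $ 2 = 0"
proof -
  have V: "V (cyl r \<theta> z) = a r z *\<^sub>R e_r \<theta> + b r z *\<^sub>R e_theta \<theta> + c r z *\<^sub>R e_z"
    if "r \<in> {0..1}" for r \<theta> z
    using assms(1) that by (simp add: axisymmetric_field_def)
  show "a r z = V (cyl r 0 z) $ 1" "b r z = V (cyl r 0 z) $ 2" "c r z = V (cyl r 0 z) $ 3"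
    using V[OF assms(2), of 0 z] by (simp_all add: e_r_def e_theta_def e_z_def)
  \<comment> \<open>The angles 0 and pi name the same axis point but give opposite
    \<open>e_r\<close> and \<open>e_theta\<close>, so both coefficients equal their
    negatives.\<close>
  have "cyl 0 pi z = cyl 0 0 z" by (simp add: cyl_def)
  then have "V (cyl 0 0 z) = V (cyl 0 pi z)" by simp
  then show "V (cyl 0 0 z) $ 1 = 0" "V (cyl 0 0 z) $ 2 = 0"
    using V[of 0 0 z] V[of 0 pi z] by (auto simp: e_r_def e_theta_def e_z_def vec_eq_iff forall_3)
qed

text \<open>The azimuthal derivative of an axisymmetric field is \<open>a e_theta - b e_r\<close>, whence the terms with \<open>1 / r\<close>.
  On the axis they vanish, in agreement with \<open>x / 0 = 0\<close>.\<close>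

lemma axisymmetric_operators:
  assumes ax: "axisymmetric_field V a b c" and diff: "V differentiable (at (cyl r 0 z) within cylinder)"
    and r: "r \<in> {0..1}"
    and dr: "\<And>i. ((\<lambda>s. V (cyl s 0 z) $ i) has_real_derivative Vr i) (at r within {0..1})"
    and dz: "\<And>i. ((\<lambda>s. V (cyl r 0 s) $ i) has_real_derivative Vz i) (at z)"
    and v: "v = V (cyl r 0 z)"
  shows "advection V (cyl r 0 z) $ 1 = v $ 1 * Vr 1 + v $ 3 * Vz 1 - (v $ 2)\<^sup>2 / r"
    and "advection V (cyl r 0 z) $ 2 = v $ 1 * Vr 2 + v $ 3 * Vz 2 + v $ 1 * v $ 2 / r"
    and "advection V (cyl r 0 z) $ 3 = v $ 1 * Vr 3 + v $ 3 * Vz 3"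
    and "r * divergence V (cyl r 0 z) = r * Vr 1 + v $ 1 + r * Vz 3"
proof -
  define D where "D = frechet_derivative V (at (cyl r 0 z) within cylinder)"
  have D: "(V has_derivative D) (at (cyl r 0 z) within cylinder)"
    using diff frechet_derivative_works D_def by blast
  have Dr: "D (axis 1 1) $ i = Vr i" for i
    using has_field_derivative_unique[OF has_vector_derivative_vec_nth[OF derivative_in_cylinder(1)[OF D r]] dr
        at_within_unit_neq_bot[OF r]] .
  have Dz: "D (axis 3 1) $ i = Vz i" for i
    using DERIV_unique[OF has_vector_derivative_vec_nth[OF derivative_in_cylinder(2)[OF D r]] dz] .
  \<comment> \<open>Axisymmetry determines \<open>V\<close> on the whole circle from the single
    value \<open>v\<close>; differentiating at \<open>\<theta> = 0\<close> gives \<open>r\<close>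
    times the derivative in the direction \<open>axis 2 1\<close>.\<close>
  have "V (cyl r \<theta> z) = v $ 1 *\<^sub>R e_r \<theta> + v $ 2 *\<^sub>R e_theta \<theta> + v $ 3 *\<^sub>R e_z" for \<theta>
    using ax[unfolded axisymmetric_field_def, rule_format, OF r, of \<theta> z]
    by (simp only: axisymmetric_fieldD(1-3)[OF ax r] v)
  then have V\<theta>: "V (cyl r \<theta> z) $ 1 = v $ 1 * cos \<theta> - v $ 2 * sin \<theta>"
    "V (cyl r \<theta> z) $ 2 = v $ 1 * sin \<theta> + v $ 2 * cos \<theta>" "V (cyl r \<theta> z) $ 3 = v $ 3" for \<theta>
    by (simp_all add: e_r_def e_theta_def e_z_def)
  have \<theta>: "((\<lambda>\<theta>. V (cyl r \<theta> z) $ i) has_real_derivative (r *\<^sub>R D (axis 2 1)) $ i) (at 0)" for i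
    by (rule has_vector_derivative_vec_nth[OF derivative_in_cylinder(3)[OF D r]])
  have D\<theta>: "r * D (axis 2 1) $ 1 = - v $ 2" "r * D (axis 2 1) $ 2 = v $ 1" "r * D (axis 2 1) $ 3 = 0"
  proof -
    have "((\<lambda>\<theta>. V (cyl r \<theta> z) $ 1) has_real_derivative - v $ 2) (at 0)"
      unfolding V\<theta> by (auto intro!: derivative_eq_intros)
    from DERIV_unique[OF \<theta> this] show "r * D (axis 2 1) $ 1 = - v $ 2" by simp
    have "((\<lambda>\<theta>. V (cyl r \<theta> z) $ 2) has_real_derivative v $ 1) (at 0)"
      unfolding V\<theta> by (auto intro!: derivative_eq_intros)
    from DERIV_unique[OF \<theta> this] show "r * D (axis 2 1) $ 2 = v $ 1" by simp
    have "((\<lambda>\<theta>. V (cyl r \<theta> z) $ 3) has_real_derivative 0) (at 0)"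
      unfolding V\<theta> by (auto intro!: derivative_eq_intros)
    from DERIV_unique[OF \<theta> this] show "r * D (axis 2 1) $ 3 = 0" by simp
  qed
  have "v = v $ 1 *\<^sub>R axis 1 1 + v $ 2 *\<^sub>R axis 2 1 + v $ 3 *\<^sub>R axis 3 1"
    by (simp add: vec_eq_iff forall_3 axis_def)
  then have "D v = D (v $ 1 *\<^sub>R axis 1 1 + v $ 2 *\<^sub>R axis 2 1 + v $ 3 *\<^sub>R axis 3 1)"
    by (rule arg_cong)
  also have "\<dots> = v $ 1 *\<^sub>R D (axis 1 1) + v $ 2 *\<^sub>R D (axis 2 1) + v $ 3 *\<^sub>R D (axis 3 1)"
    using has_derivative_linear[OF D] by (simp add: linear_add linear_cmul)
  finally have Dv: "D v $ i = v $ 1 * Vr i + v $ 2 * D (axis 2 1) $ i + v $ 3 * Vz i" for i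
    by (simp add: Dr Dz)
  have adv: "advection V (cyl r 0 z) = D v"
    using fun_cong[OF matrix_vector_mul(2)[OF has_derivative_linear[OF D]]]
    by (simp add: advection_def jacobian_def v flip: D_def)
  have axis: "v $ 2 = 0" if "r = 0" using axisymmetric_fieldD(5)[OF ax r] that by (simp add: v)
  have "v $ 2 * D (axis 2 1) $ 1 = - ((v $ 2)\<^sup>2 / r)"
  proof (cases "r = 0")
    case False
    then have "D (axis 2 1) $ 1 = - v $ 2 / r" using D\<theta>(1) by (simp add: field_simps)
    then show ?thesis by (simp add: power2_eq_square)
  qed (use axis in simp)
  then show "advection V (cyl r 0 z) $ 1 = v $ 1 * Vr 1 + v $ 3 * Vz 1 - (v $ 2)\<^sup>2 / r"
    by (simp add: adv Dv)
  have "v $ 2 * D (axis 2 1) $ 2 = v $ 1 * v $ 2 / r"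
  proof (cases "r = 0")
    case False
    then have "D (axis 2 1) $ 2 = v $ 1 / r" using D\<theta>(2) by (simp add: field_simps)
    then show ?thesis by simp
  qed (use axis in simp)
  then show "advection V (cyl r 0 z) $ 2 = v $ 1 * Vr 2 + v $ 3 * Vz 2 + v $ 1 * v $ 2 / r"
    by (simp add: adv Dv)
  have "v $ 2 * D (axis 2 1) $ 3 = 0"
    using D\<theta>(3) axis by auto
  then show "advection V (cyl r 0 z) $ 3 = v $ 1 * Vr 3 + v $ 3 * Vz 3"
    by (simp add: adv Dv)
  have "divergence V (cyl r 0 z) = D (axis 1 1) $ 1 + D (axis 2 1) $ 2 + D (axis 3 1) $ 3"
    by (simp add: divergence_def jacobian_def trace_def sum_3 matrix_def flip: D_def)
  then show "r * divergence V (cyl r 0 z) = r * Vr 1 + v $ 1 + r * Vz 3"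
    using D\<theta>(2) by (simp add: Dr Dz algebra_simps)
qed

section \<open>Global axisymmetric solutions as solutions of the planar system\<close>

lemma time_interval_infinity: "time_interval \<infinity> = {0..}"
  by (auto simp: time_interval_def)

lemma Ck_on_Suc_differentiable: "Ck_on (Suc k) S f \<Longrightarrow> x \<in> S \<Longrightarrow> f differentiable (at x within S)"
  unfolding Ck_on.simps differentiable_def by blast

lemma euler_solutionD:
  assumes "euler_solution \<infinity> U0 U P"
  shows "Ck_on k ({0..} \<times> cylinder) (\<lambda>(t, x). U t x)"
    and "x \<in> cylinder \<Longrightarrow> U 0 x = U0 x"
    and "0 \<le> t \<Longrightarrow> z_periodic (U t)"
    and "0 \<le> t \<Longrightarrow> z_periodic (P t)"
    and "0 \<le> t \<Longrightarrow> Ck_on k cylinder (P t)"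
    and "0 \<le> t \<Longrightarrow> U t (cyl 1 \<theta> z) \<bullet> e_r \<theta> = 0"
    and "0 \<le> t \<Longrightarrow> x \<in> cylinder \<Longrightarrow> divergence (U t) x = 0"
    and "0 \<le> t \<Longrightarrow> x \<in> cylinder \<Longrightarrow>
      vector_derivative (\<lambda>s. U s x) (at t within {0..}) + advection (U t) x = - gradient (P t) x"
proof -
  note * = assms[unfolded euler_solution_def is_pressure_def smooth_on_def time_interval_infinity]
  show "Ck_on k ({0..} \<times> cylinder) (\<lambda>(t, x). U t x)" "x \<in> cylinder \<Longrightarrow> U 0 x = U0 x"
    using * by blast+
  assume "0 \<le> t"
  then have "t \<in> {0..}" by simp
  with * show "z_periodic (U t)" "z_periodic (P t)" "Ck_on k cylinder (P t)" "U t (cyl 1 \<theta> z) \<bullet> e_r \<theta> = 0"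
    "x \<in> cylinder \<Longrightarrow> divergence (U t) x = 0"
    "x \<in> cylinder \<Longrightarrow>
      vector_derivative (\<lambda>s. U s x) (at t within {0..}) + advection (U t) x = - gradient (P t) x"
    by blast+
qed

text \<open>The derivatives \<open>Ut\<close>, \<open>Ur\<close>, \<open>Uz\<close> are arguments
  because the blowup argument differentiates these same functions once more.\<close>

lemma euler_solution_meridional:
  assumes sol: "euler_solution \<infinity> U0 U P"
    and ax: "\<And>t. 0 \<le> t \<Longrightarrow> axisymmetric_field (U t) (a t) (b t) (c t)"
    and axP: "\<And>t. 0 \<le> t \<Longrightarrow> axisymmetric_scalar (P t) (p t)"
    and C1: "\<And>i. C1_trz (\<lambda>t r z. U t (cyl r 0 z) $ i) (\<lambda>t r z. Ut (t, cyl r 0 z) $ i)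
      (\<lambda>t r z. Ur (t, cyl r 0 z) $ i) (\<lambda>t r z. Uz (t, cyl r 0 z) $ i)"
    and Ut: "\<And>t r z. 0 \<le> t \<Longrightarrow> r \<in> {0..1} \<Longrightarrow>
      ((\<lambda>s. U s (cyl r 0 z)) has_vector_derivative Ut (t, cyl r 0 z)) (at t within {0..})"
  shows "meridional_euler
    (\<lambda>t r z. U t (cyl r 0 z) $ 1) (\<lambda>t r z. Ut (t, cyl r 0 z) $ 1) (\<lambda>t r z. Ur (t, cyl r 0 z) $ 1) (\<lambda>t r z. Uz (t, cyl r 0 z) $ 1)
    (\<lambda>t r z. U t (cyl r 0 z) $ 2) (\<lambda>t r z. Ut (t, cyl r 0 z) $ 2) (\<lambda>t r z. Ur (t, cyl r 0 z) $ 2) (\<lambda>t r z. Uz (t, cyl r 0 z) $ 2)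
    (\<lambda>t r z. U t (cyl r 0 z) $ 3) (\<lambda>t r z. Ut (t, cyl r 0 z) $ 3) (\<lambda>t r z. Ur (t, cyl r 0 z) $ 3) (\<lambda>t r z. Uz (t, cyl r 0 z) $ 3)
    (\<lambda>t r z. P t (cyl r 0 z)) (\<lambda>t r z. gradient (P t) (cyl r 0 z) $ 1) (\<lambda>t r z. gradient (P t) (cyl r 0 z) $ 3)"
proof -
  have smooth: "Ck_on (Suc 0) ({0..} \<times> cylinder) (\<lambda>(t, x). U t x)"
    by (rule euler_solutionD(1)[OF sol])
  have diff: "U t differentiable (at x within cylinder)" if "0 \<le> t" "x \<in> cylinder" for t x
  proof -
    have "(t, x) \<in> {0..} \<times> cylinder" using that by simp
    from Ck_on_Suc_differentiable[OF smooth this]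
    obtain F' where F': "((\<lambda>(t, x). U t x) has_derivative F') (at (t, x) within {0..} \<times> cylinder)"
      unfolding differentiable_def by blast
    \<comment> \<open>Smoothness is assumed jointly in space-time; composing with the embedding of a
      time slice gives the spatial derivative.\<close>
    have "((\<lambda>x. (t, x)) has_derivative (\<lambda>h. (0, h))) (at x within cylinder)"
      by (intro has_derivative_Pair has_derivative_const has_derivative_ident)
    moreover have "(\<lambda>x. (t, x)) ` cylinder \<subseteq> {0..} \<times> cylinder" using that by auto
    ultimately have "((\<lambda>x. case (t, x) of (t, x) \<Rightarrow> U t x) has_derivative (\<lambda>h. F' (0, h))) (at x within cylinder)"
      using has_derivative_in_compose[where f = "\<lambda>x. (t, x)"] has_derivative_subset[OF F'] by blast
    then have "(U t has_derivative (\<lambda>h. F' (0, h))) (at x within cylinder)" by simp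
    then show ?thesis unfolding differentiable_def by blast
  qed
  have P: "Ck_on (Suc 0) cylinder (P t)" if "0 \<le> t" for t
    by (rule euler_solutionD(5)[OF sol that])
  have diffP: "P t differentiable (at x within cylinder)" if "0 \<le> t" "x \<in> cylinder" for t x
    by (rule Ck_on_Suc_differentiable[OF P[OF that(1)] that(2)])
  have dr: "((\<lambda>s. U t (cyl s 0 z) $ i) has_real_derivative Ur (t, cyl r 0 z) $ i) (at r within {0..1})"
    and dz: "((\<lambda>s. U t (cyl r 0 s) $ i) has_real_derivative Uz (t, cyl r 0 z) $ i) (at z)"
    if "0 \<le> t" "r \<in> {0..1}" for t r z i
    using C1[of i] that by (auto simp: C1_trz_def)
  have op: "advection (U t) (cyl r 0 z) $ 1 = U t (cyl r 0 z) $ 1 * Ur (t, cyl r 0 z) $ 1 +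
        U t (cyl r 0 z) $ 3 * Uz (t, cyl r 0 z) $ 1 - (U t (cyl r 0 z) $ 2)\<^sup>2 / r"
      "advection (U t) (cyl r 0 z) $ 2 = U t (cyl r 0 z) $ 1 * Ur (t, cyl r 0 z) $ 2 +
        U t (cyl r 0 z) $ 3 * Uz (t, cyl r 0 z) $ 2 + U t (cyl r 0 z) $ 1 * U t (cyl r 0 z) $ 2 / r"
      "advection (U t) (cyl r 0 z) $ 3 = U t (cyl r 0 z) $ 1 * Ur (t, cyl r 0 z) $ 3 +
        U t (cyl r 0 z) $ 3 * Uz (t, cyl r 0 z) $ 3"
      "r * divergence (U t) (cyl r 0 z) = r * Ur (t, cyl r 0 z) $ 1 + U t (cyl r 0 z) $ 1 + r * Uz (t, cyl r 0 z) $ 3"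
    if t: "0 \<le> t" and r: "r \<in> {0..1}" for t r z
    by (rule axisymmetric_operators[OF ax[OF t] diff[OF t cyl_in_cylinder[OF r]] r dr[OF t r] dz[OF t r] refl])+
  have mom: "Ut (t, cyl r 0 z) $ i + advection (U t) (cyl r 0 z) $ i = - gradient (P t) (cyl r 0 z) $ i"
    if t: "0 \<le> t" and r: "r \<in> {0..1}" for t r z i
  proof -
    have "vector_derivative (\<lambda>s. U s (cyl r 0 z)) (at t within {0..}) = Ut (t, cyl r 0 z)"
      by (rule vector_derivative_within[OF at_within_halfline_neq_bot[OF t] Ut[OF t r]])
    then have "Ut (t, cyl r 0 z) + advection (U t) (cyl r 0 z) = - gradient (P t) (cyl r 0 z)"
      using euler_solutionD(8)[OF sol t cyl_in_cylinder[OF r, of 0 z]] by simp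
    then show ?thesis by (metis vector_add_component vector_uminus_component)
  qed
  have axis: "U t (cyl 0 0 z) $ 1 = 0" "U t (cyl 0 0 z) $ 2 = 0" if "0 \<le> t" for t z
    using axisymmetric_fieldD(4,5)[OF ax[OF that], of 0] by auto
  show ?thesis
  proof (rule meridional_euler.intro[OF C1 C1 C1], goal_cases)
    case (1 t)
    obtain fr fz where *: "C1_rz (\<lambda>r z. P t (cyl r 0 z)) (\<lambda>r z. fr (cyl r 0 z)) (\<lambda>r z. fz (cyl r 0 z))"
      "\<And>r z. r \<in> {0..1} \<Longrightarrow> gradient (P t) (cyl r 0 z) $ 1 = fr (cyl r 0 z)"
      "\<And>r z. r \<in> {0..1} \<Longrightarrow> gradient (P t) (cyl r 0 z) $ 3 = fz (cyl r 0 z)"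
      by (rule Ck_on_gradient[OF P[OF 1]]) (rule that; assumption)
    show ?case by (rule C1_rz_cong[OF *(1)]) (simp add: *(2,3))
  next
    case (2 t r z)
    show ?case
      using euler_solutionD(3,4)[OF sol 2(1)] cyl_in_cylinder[OF 2(2)] by (simp add: z_periodic_def cyl_periodic)
  next
    case (5 t z)
    from euler_solutionD(6)[OF sol 5, of 0 z] show ?case by (simp add: e_r_def inner_vec_def sum_3)
  next
    case (6 t r z)
    show ?case using euler_solutionD(7)[OF sol 6(1) cyl_in_cylinder[OF 6(2)], of 0 z] op(4)[OF 6, of z] by simp
  next
    case (7 t r z)
    show ?case
      using mom[OF 7, of z 1] op(1)[OF 7, of z] by simp
  next
    case (8 t r z)
    show ?case
    proof (cases "r = 0")
      \<comment> \<open>On the axis the azimuthal pressure derivative is not controlled by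
        axisymmetry along circles. The equation holds there term by term instead: \<open>B\<close>
        is identically 0 along the axis, hence so are its derivatives in \<open>t\<close> and
        \<open>z\<close>, and the other terms contain \<open>A\<close>.\<close>
      case True
      have "((\<lambda>s. U s (cyl 0 0 z) $ 2) has_real_derivative 0) (at t within {0..})"
        by (rule has_field_derivative_transform_within[OF DERIV_const zero_less_one]) (use axis 8 in auto)
      moreover have "((\<lambda>s. U s (cyl 0 0 z) $ 2) has_real_derivative Ut (t, cyl 0 0 z) $ 2) (at t within {0..})"
        using C1[of 2] 8 by (auto simp: C1_trz_def)
      ultimately have "Ut (t, cyl 0 0 z) $ 2 = 0"
        using has_field_derivative_unique at_within_halfline_neq_bot 8 by blast
      moreover have "Uz (t, cyl 0 0 z) $ 2 = 0"
        using dz[OF 8(1), of 0 2 z] axis(2)[OF 8(1)] by (auto intro: DERIV_unique)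
      ultimately show ?thesis using True axis[OF 8(1)] by simp
    next
      case False
      then have "gradient (P t) (cyl r 0 z) $ 2 = 0"
        using 8 by (intro axisymmetric_gradient_theta[OF axP] diffP cyl_in_cylinder) auto
      then show ?thesis
        using mom[OF 8, of z 2] op(2)[OF 8, of z] by simp
    qed
  next
    case (9 t r z)
    show ?case
      using mom[OF 9, of z 3] op(3)[OF 9, of z] by simp
  qed (use axis in auto)
qed

section \<open>Blowup\<close>

text \<open>The difference quotient at 0 is \<open>f r / r * (g r / r)\<close>, a product of the two
  difference quotients, because the function itself has value 0 at 0.\<close>

lemma derivative_mult_div_at_0:
  fixes f g :: "real \<Rightarrow> real"
  assumes "(f has_real_derivative df) (at 0 within S)" "(g has_real_derivative dg) (at 0 within S)"
    and "f 0 = 0" "g 0 = 0"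
  shows "((\<lambda>r. f r * g r / r) has_real_derivative df * dg) (at 0 within S)"
proof -
  have "((\<lambda>r. f r / r * (g r / r)) \<longlongrightarrow> df * dg) (at 0 within S)"
    using assms by (intro tendsto_mult) (simp_all add: has_field_derivative_iff)
  then show ?thesis
    by (simp add: has_field_derivative_iff)
qed

text \<open>The reason for the two forms of \<open>swirl_coeff\<close>: away from the axis it is
  enough that \<open>f\<close> vanishes at \<open>r0\<close>, while at \<open>r0 = 0\<close> the
  derivative of the quotient is \<open>d\<^sup>2\<close>, so the first derivative has to vanish
  too.\<close>

lemma derivative_square_div:
  fixes f :: "real \<Rightarrow> real"
  assumes "(f has_real_derivative d) (at r0 within S)" "f r0 = 0" "r0 = 0 \<Longrightarrow> d = 0"
  shows "((\<lambda>r. (f r)\<^sup>2 / r) has_real_derivative 0) (at r0 within S)"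
proof (cases "r0 = 0")
  case True
  then show ?thesis
    using derivative_mult_div_at_0[of f d S f d] assms by (simp add: power2_eq_square)
next
  case False
  show ?thesis
    by (rule derivative_eq_intros assms(1) refl False | simp add: assms(2))+
qed

lemma cont3_slice:
  assumes "cont3 f"
  shows "continuous_on ({0..} \<times> {0..1}) (\<lambda>(t, r). f t r z)"
    and "r \<in> {0..1} \<Longrightarrow> continuous_on ({0..} \<times> S) (\<lambda>(t, z). f t r z)"
    and "r \<in> {0..1} \<Longrightarrow> continuous_on {0..} (\<lambda>t. f t r z)"
  unfolding split_def
  by (rule cont3_compose[OF assms, where \<phi> = "\<lambda>p. (fst p, snd p, z)", simplified]
        cont3_compose[OF assms, where \<phi> = "\<lambda>p. (fst p, r, snd p)", simplified]
        cont3_compose[OF assms, where \<phi> = "\<lambda>t. (t, r, z)", simplified];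
      auto intro!: continuous_intros)+

text \<open>Differentiating a momentum equation in space produces a space derivative of
  \<open>ft\<close>; the Riccati inequality needs it as the time derivative of \<open>fr\<close> or
  \<open>fz\<close>.\<close>

lemma C1_trz_time_derivative_of_partial:
  assumes f: "C1_trz f ft fr fz" and ft: "C1_trz ft ftt ftr ftz" and t: "0 \<le> t" and r: "r \<in> {0..1}"
  shows "((\<lambda>t. fr t r z) has_real_derivative ftr t r z) (at t within {0..})"
    and "((\<lambda>t. fz t r z) has_real_derivative ftz t r z) (at t within {0..})"
proof -
  have c: "cont3 ft" "cont3 ftr" "cont3 ftz" using f ft by (simp_all add: C1_trz_def)
  have d: "((\<lambda>s. f s r z) has_real_derivative ft t r z) (at t within {0..})"
    "((\<lambda>s. f t s z) has_real_derivative fr t r z) (at r within {0..1})"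
    "((\<lambda>s. ft t s z) has_real_derivative ftr t r z) (at r within {0..1})"
    "((\<lambda>s. f t r s) has_real_derivative fz t r z) (at z within S)"
    "((\<lambda>s. ft t r s) has_real_derivative ftz t r z) (at z within S)"
    if "0 \<le> t" "r \<in> {0..1}" for t r z S
    using f ft that by (auto simp: C1_trz_def intro: has_field_derivative_at_within)
  show "((\<lambda>t. fr t r z) has_real_derivative ftr t r z) (at t within {0..})"
    by (rule derivative_of_derivative_swap[where f = "\<lambda>t r. f t r z" and ft = "\<lambda>t r. ft t r z"
          and fts = "\<lambda>t r. ftr t r z" and l = 0 and u = 1])
       (use d r t cont3_slice(1)[OF c(2)] cont3_slice(3)[OF c(1)] in auto)
  show "((\<lambda>t. fz t r z) has_real_derivative ftz t r z) (at t within {0..})"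
    \<comment> \<open>Any compact interval with \<open>z\<close> in its interior would do; the
      derivative within it is the ordinary one at \<open>z\<close>.\<close>
    by (rule derivative_of_derivative_swap[where f = "\<lambda>t. f t r" and ft = "\<lambda>t. ft t r"
          and fts = "\<lambda>t. ftz t r" and l = "z - 1" and u = "z + 1"])
       (use d r t cont3_slice(2)[OF c(3) r] cont3_slice(3)[OF c(1) r] in auto)
qed

lemma partial_r_eq:
  assumes "((\<lambda>s. g s z) has_real_derivative d) (at r within {0..1})" "r \<in> {0..1}"
    and "\<And>s. s \<in> {0..1} \<Longrightarrow> f s z = g s z"
  shows "partial_r f r z = d"
proof -
  have "((\<lambda>s. f s z) has_real_derivative d) (at r within {0..1})"
    by (rule has_field_derivative_transform_within[OF assms(1) zero_less_one assms(2)]) (simp add: assms(3))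
  then show ?thesis
    unfolding partial_r_def has_real_derivative_iff_has_vector_derivative
    by (rule vector_derivative_within[OF at_within_unit_neq_bot[OF assms(2)]])
qed

lemma partial_z_eq:
  assumes "((\<lambda>s. g r s) has_real_derivative d) (at z)" "\<And>s. f r s = g r s"
  shows "partial_z f r z = d"
  using assms by (simp add: partial_z_def DERIV_imp_deriv)

theorem theorem3p1:
  fixes T :: ereal
    and U0 :: "real ^ 3 \<Rightarrow> real ^ 3" and a0 b0 c0 :: "real \<Rightarrow> real \<Rightarrow> real"
    and U :: "real \<Rightarrow> real ^ 3 \<Rightarrow> real ^ 3" and a b c :: "real \<Rightarrow> real \<Rightarrow> real \<Rightarrow> real"
    and P :: "real \<Rightarrow> real ^ 3 \<Rightarrow> real" and p :: "real \<Rightarrow> real \<Rightarrow> real \<Rightarrow> real"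
    and r0 :: real
  assumes "maximal_euler_solution T U0 U P"
    and "axisymmetric_field U0 a0 b0 c0"
    and "\<forall>t\<in>time_interval T. axisymmetric_field (U t) (a t) (b t) (c t)"
    and "\<forall>t\<in>time_interval T. axisymmetric_scalar (P t) (p t)"
    and "odd_in_z c0" and "even_in_z a0" and "odd_in_z b0 \<or> even_in_z b0"
    and "r0 = 0 \<or> r0 = 1"
    and "((\<forall>t\<in>time_interval T. partial_r (partial_r (p t)) r0 0 \<ge> 0) \<and>
            partial_r (a 0) r0 0 < 0 \<and> swirl_coeff b0 r0 = 0) \<or>
         ((\<forall>t\<in>time_interval T. partial_z (partial_z (p t)) r0 0 \<ge> 0) \<and>
            partial_z (c 0) r0 0 < 0)"
  shows "T < \<infinity>"
proof (rule ccontr)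
  assume "\<not> T < \<infinity>"
  then have T: "T = \<infinity>" by simp
  have sol: "euler_solution \<infinity> U0 U P"
    using assms(1) by (simp add: maximal_euler_solution_def T)
  have ax: "axisymmetric_field (U t) (a t) (b t) (c t)" and axP: "axisymmetric_scalar (P t) (p t)"
    if "0 \<le> t" for t
    using assms(3,4) that by (auto simp: T time_interval_infinity)
  have r0: "r0 \<in> {0..1}" using assms(8) by auto

  \<comment> \<open>Order two: one derivative for the equations, one more to differentiate them in
    \<open>r\<close> or \<open>z\<close>.\<close>
  have "Ck_on (Suc (Suc 0)) ({0..} \<times> cylinder) (\<lambda>(t, x). U t x)"
    by (rule euler_solutionD(1)[OF sol])
  then obtain Ut Ur Uz where
    Ck: "Ck_on (Suc 0) ({0..} \<times> cylinder) Ut" "Ck_on (Suc 0) ({0..} \<times> cylinder) Ur" "Ck_on (Suc 0) ({0..} \<times> cylinder) Uz"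
    and U: "\<And>i. C1_trz (\<lambda>t r z. U t (cyl r 0 z) $ i) (\<lambda>t r z. Ut (t, cyl r 0 z) $ i)
      (\<lambda>t r z. Ur (t, cyl r 0 z) $ i) (\<lambda>t r z. Uz (t, cyl r 0 z) $ i)"
    and dt: "\<And>t r z. 0 \<le> t \<Longrightarrow> r \<in> {0..1} \<Longrightarrow>
      ((\<lambda>s. U s (cyl r 0 z)) has_vector_derivative Ut (t, cyl r 0 z)) (at t within {0..})"
    by (rule Ck_on_spacetime_partials) (rule that; simp only: prod.case)
  obtain Utt Utr Utz where Ut: "\<And>i. C1_trz (\<lambda>t r z. Ut (t, cyl r 0 z) $ i) (\<lambda>t r z. Utt (t, cyl r 0 z) $ i)
      (\<lambda>t r z. Utr (t, cyl r 0 z) $ i) (\<lambda>t r z. Utz (t, cyl r 0 z) $ i)"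
    using Ck(1) by (rule Ck_on_spacetime_partials) (rule that; assumption)
  obtain Urt Urr Urz where Ur: "\<And>i. C1_trz (\<lambda>t r z. Ur (t, cyl r 0 z) $ i) (\<lambda>t r z. Urt (t, cyl r 0 z) $ i)
      (\<lambda>t r z. Urr (t, cyl r 0 z) $ i) (\<lambda>t r z. Urz (t, cyl r 0 z) $ i)"
    using Ck(2) by (rule Ck_on_spacetime_partials) (rule that; assumption)
  obtain Uzt Uzr Uzz where Uz: "\<And>i. C1_trz (\<lambda>t r z. Uz (t, cyl r 0 z) $ i) (\<lambda>t r z. Uzt (t, cyl r 0 z) $ i)
      (\<lambda>t r z. Uzr (t, cyl r 0 z) $ i) (\<lambda>t r z. Uzz (t, cyl r 0 z) $ i)"
    using Ck(3) by (rule Ck_on_spacetime_partials) (rule that; assumption)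

  let ?A = "\<lambda>t r z. U t (cyl r 0 z) $ 1" and ?B = "\<lambda>t r z. U t (cyl r 0 z) $ 2" and ?C = "\<lambda>t r z. U t (cyl r 0 z) $ 3"
  let ?At = "\<lambda>t r z. Ut (t, cyl r 0 z) $ 1" and ?Bt = "\<lambda>t r z. Ut (t, cyl r 0 z) $ 2" and ?Ct = "\<lambda>t r z. Ut (t, cyl r 0 z) $ 3"
  let ?Ar = "\<lambda>t r z. Ur (t, cyl r 0 z) $ 1" and ?Br = "\<lambda>t r z. Ur (t, cyl r 0 z) $ 2" and ?Cr = "\<lambda>t r z. Ur (t, cyl r 0 z) $ 3"
  let ?Az = "\<lambda>t r z. Uz (t, cyl r 0 z) $ 1" and ?Bz = "\<lambda>t r z. Uz (t, cyl r 0 z) $ 2" and ?Cz = "\<lambda>t r z. Uz (t, cyl r 0 z) $ 3"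
  let ?p = "\<lambda>t r z. P t (cyl r 0 z)"
  let ?pr = "\<lambda>t r z. gradient (P t) (cyl r 0 z) $ 1" and ?pz = "\<lambda>t r z. gradient (P t) (cyl r 0 z) $ 3"
  interpret s: meridional_euler ?A ?At ?Ar ?Az ?B ?Bt ?Br ?Bz ?C ?Ct ?Cr ?Cz ?p ?pr ?pz
    by (rule euler_solution_meridional[OF sol ax axP U dt])

  have U0: "U 0 (cyl r 0 z) = U0 (cyl r 0 z)" if "r \<in> {0..1}" for r z
    by (rule euler_solutionD(2)[OF sol cyl_in_cylinder[OF that]])
  note init = axisymmetric_fieldD(1-3)[OF assms(2)]
  obtain \<epsilon> :: real where \<epsilon>: "\<epsilon> * \<epsilon> = 1" "\<And>r z. r \<in> {0..1} \<Longrightarrow> z \<in> {-pi..pi} \<Longrightarrow> b0 r z = \<epsilon> * b0 r (- z)"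
  proof (cases "even_in_z b0")
    case True
    then show thesis by (intro that[of 1]) (auto simp: even_in_z_def)
  next
    case False
    then show thesis using assms(7) by (intro that[of "-1"]) (auto simp: odd_in_z_def)
  qed
  have C0: "?C t r 0 = 0" if t: "0 \<le> t" and r: "r \<in> {0..1}" for t r
  proof -
    \<comment> \<open>Uniqueness evaluated at the fixed point \<open>z = 0\<close> of the
      reflection.\<close>
    have "?C t r 0 = -1 * ?C t r (-0)"
    proof (rule meridional_euler_unique[OF s.meridional_euler_axioms s.reflected[OF \<epsilon>(1)] _ t r,
          THEN conjunct2, THEN conjunct2])
      fix r z :: real assume rz: "r \<in> {0..1}" "z \<in> {-pi..pi}"
      show "?A 0 r z = ?A 0 r (-z) \<and> ?B 0 r z = \<epsilon> * ?B 0 r (-z) \<and> ?C 0 r z = -1 * ?C 0 r (-z)"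
        using assms(5,6) \<epsilon>(2)[OF rz] rz by (simp add: U0 odd_in_z_def even_in_z_def flip: init)
    qed simp
    then show ?thesis by simp
  qed
  have A0: "?A t r0 z = 0" if "0 \<le> t" for t z
    using s.axis(1)[OF that] s.wall[OF that] assms(8) by auto
  consider (r) "\<And>t. 0 \<le> t \<Longrightarrow> partial_r (partial_r (p t)) r0 0 \<ge> 0" "partial_r (a 0) r0 0 < 0" "swirl_coeff b0 r0 = 0"
    | (z) "\<And>t. 0 \<le> t \<Longrightarrow> partial_z (partial_z (p t)) r0 0 \<ge> 0" "partial_z (c 0) r0 0 < 0"
    using assms(9) unfolding T time_interval_infinity by auto
  then show False
  proof cases
    case z
    have swap: "((\<lambda>t. ?Cz t r0 0) has_real_derivative Utz (t, cyl r0 0 0) $ 3) (at t within {0..})" if t: "0 \<le> t" for t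
      by (rule C1_trz_time_derivative_of_partial(2)[OF U Ut t r0])
    show False
    proof (rule riccati_blowup[OF swap])
      fix t :: real assume t: "0 \<le> t"
      \<comment> \<open>\<open>A\<close> vanishes on the whole line \<open>r = r0\<close>, so its
        term drops out before differentiating in \<open>z\<close>; afterwards the second
        z-derivative of \<open>C\<close> is multiplied by \<open>C = 0\<close>.\<close>
      have pz: "?pz t r0 = (\<lambda>z. - (?Ct t r0 z + ?C t r0 z * ?Cz t r0 z))"
        using s.momentum_z[OF t r0] A0[OF t] by (auto simp: fun_eq_iff)
      have "((\<lambda>z. ?Ct t r0 z) has_real_derivative Utz (t, cyl r0 0 0) $ 3) (at 0)"
        "((\<lambda>z. ?C t r0 z) has_real_derivative ?Cz t r0 0) (at 0)"
        "((\<lambda>z. ?Cz t r0 z) has_real_derivative Uzz (t, cyl r0 0 0) $ 3) (at 0)"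
        using U[of 3] Ut[of 3] Uz[of 3] t r0 by (auto simp: C1_trz_def)
      note d = this
      have dpz: "(?pz t r0 has_real_derivative - (Utz (t, cyl r0 0 0) $ 3 + (?Cz t r0 0)\<^sup>2)) (at 0)"
        unfolding pz
        by (rule derivative_eq_intros d refl | simp add: C0[OF t r0] power2_eq_square)+
      have peq: "p t r0 z = ?p t r0 z" for z
        using axP[OF t] r0 by (auto simp: axisymmetric_scalar_def)
      have "partial_z (p t) r0 z = ?pz t r0 z" for z
        by (rule partial_z_eq[where g = "?p t"]) (use s.p[OF t] r0 peq in \<open>auto simp: C1_rz_def\<close>)
      then have "partial_z (partial_z (p t)) r0 0 = - (Utz (t, cyl r0 0 0) $ 3 + (?Cz t r0 0)\<^sup>2)"
        by (rule partial_z_eq[where g = "?pz t", OF dpz])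
      then show "Utz (t, cyl r0 0 0) $ 3 \<le> - (?Cz t r0 0)\<^sup>2" using z(1)[OF t] by simp
    next
      have "partial_z (c 0) r0 0 = ?Cz 0 r0 0"
        by (rule partial_z_eq[where g = "?C 0"])
           (use U[of 3] r0 axisymmetric_fieldD(3)[OF ax[of 0] r0] in \<open>auto simp: C1_trz_def\<close>)
      then show "?Cz 0 r0 0 < 0" using z(2) by simp
    qed
  next
    case r
    have swap: "((\<lambda>t. Ur (t, cyl r 0 0) $ i) has_real_derivative Utr (t, cyl r 0 0) $ i) (at t within {0..})"
      if t: "0 \<le> t" and r: "r \<in> {0..1}" for t r i
      by (rule C1_trz_time_derivative_of_partial(1)[OF U Ut t r])
    have d: "((\<lambda>r. Ut (t, cyl r 0 0) $ i) has_real_derivative Utr (t, cyl r 0 0) $ i) (at r within {0..1})"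
        "((\<lambda>r. U t (cyl r 0 0) $ i) has_real_derivative Ur (t, cyl r 0 0) $ i) (at r within {0..1})"
        "((\<lambda>r. Ur (t, cyl r 0 0) $ i) has_real_derivative Urr (t, cyl r 0 0) $ i) (at r within {0..1})"
      if "0 \<le> t" "r \<in> {0..1}" for t r i
      using U[of i] Ut[of i] Ur[of i] that by (auto simp: C1_trz_def)
    have b0: "b0 r z = ?B 0 r z" if "r \<in> {0..1}" for r z
      using init(2)[OF that] U0[OF that] by simp
    have B1: "?B t 1 0 = 0" if "r0 = 1" "0 \<le> t" for t
    proof (rule linear_ode_zero[where y = "\<lambda>t. ?B t 1 0" and k = "\<lambda>t. 0"])
      fix t :: real assume t: "0 \<le> t"
      \<comment> \<open>At the wall point both transport velocities vanish, and so does the term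
        with \<open>A * B\<close>: the swirl is constant in time there.\<close>
      have "?Bt t 1 0 = 0"
        using s.momentum_theta[OF t, of 1 0] C0[OF t, of 1] s.wall[OF t, of 0] by simp
      moreover have "((\<lambda>t. ?B t 1 0) has_real_derivative ?Bt t 1 0) (at t within {0..})"
        using U[of 2] t by (auto simp: C1_trz_def)
      ultimately show "((\<lambda>t. ?B t 1 0) has_real_derivative 0 * ?B t 1 0) (at t within {0..})" by simp
    qed (use r(3) that b0[of 1 0] in \<open>auto simp: swirl_coeff_def\<close>)
    have B0: "?Br t 0 0 = 0" if "r0 = 0" "0 \<le> t" for t
    proof (rule linear_ode_zero[where y = "\<lambda>t. ?Br t 0 0" and k = "\<lambda>t. - 2 * ?Ar t 0 0"])
      fix t :: real assume t: "0 \<le> t"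
      \<comment> \<open>Transport and the quotient each contribute \<open>Ar * Br\<close> on the
        axis, hence the factor 2. The term with \<open>C\<close> is absent because \<open>C\<close>
        vanishes for all \<open>r\<close> on \<open>z = 0\<close>.\<close>
      have "((\<lambda>r. - (?A t r 0 * ?Br t r 0 + ?A t r 0 * ?B t r 0 / r)) has_real_derivative
          - 2 * ?Ar t 0 0 * ?Br t 0 0) (at 0 within {0..1})"
        by (rule derivative_eq_intros d[OF t] derivative_mult_div_at_0 s.axis[OF t] refl | simp add: s.axis[OF t])+
      then have "((\<lambda>r. ?Bt t r 0) has_real_derivative - 2 * ?Ar t 0 0 * ?Br t 0 0) (at 0 within {0..1})"
      proof (rule has_field_derivative_transform_within[OF _ zero_less_one])
        show "- (?A t r 0 * ?Br t r 0 + ?A t r 0 * ?B t r 0 / r) = ?Bt t r 0" if "r \<in> {0..1}" for r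
          using s.momentum_theta[OF t that, of 0] C0[OF t that] by simp
      qed simp
      then have "Utr (t, cyl 0 0 0) $ 2 = - 2 * ?Ar t 0 0 * ?Br t 0 0"
        using has_field_derivative_unique[OF d(1)[OF t]] at_within_unit_neq_bot[of 0] by simp
      then show "((\<lambda>t. ?Br t 0 0) has_real_derivative - 2 * ?Ar t 0 0 * ?Br t 0 0) (at t within {0..})"
        using swap[OF t, of 0 2] by simp
    next
      have "cont3 ?Ar" using U[of 1] by (simp add: C1_trz_def)
      then show "continuous_on {0..} (\<lambda>t. - 2 * ?Ar t 0 0)"
        by (intro continuous_intros cont3_slice(3)[of ?Ar]) auto
      have "partial_r b0 0 0 = ?Br 0 0 0"
        by (rule partial_r_eq[where g = "?B 0", OF d(2)]) (simp_all add: b0)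
      then show "?Br 0 0 0 = 0" using r(3) that by (simp add: swirl_coeff_def)
    qed fact
    show False
    proof (rule riccati_blowup[OF swap[OF _ r0, of _ 1]])
      fix t :: real assume t: "0 \<le> t"
      have "?B t r0 0 = 0" using assms(8) s.axis(2)[OF t] B1[OF _ t] by auto
      moreover have "r0 = 0 \<Longrightarrow> ?Br t r0 0 = 0" using B0[OF _ t] by simp
      ultimately have swirl: "((\<lambda>r. (?B t r 0)\<^sup>2 / r) has_real_derivative 0) (at r0 within {0..1})"
        by (intro derivative_square_div[OF d(2)[OF t r0]])
      \<comment> \<open>Again the term \<open>C * Az\<close> is gone on the whole line
        \<open>z = 0\<close>, and the second r-derivative of \<open>A\<close> is multiplied by
        \<open>A = 0\<close> at \<open>r0\<close>.\<close>
      have "((\<lambda>r. - (?At t r 0 + ?A t r 0 * ?Ar t r 0 - (?B t r 0)\<^sup>2 / r)) has_real_derivative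
          - (Utr (t, cyl r0 0 0) $ 1 + (?Ar t r0 0)\<^sup>2)) (at r0 within {0..1})"
        by (rule derivative_eq_intros swirl d[OF t r0] refl | simp add: A0[OF t] power2_eq_square)+
      then have dpr: "((\<lambda>r. ?pr t r 0) has_real_derivative
          - (Utr (t, cyl r0 0 0) $ 1 + (?Ar t r0 0)\<^sup>2)) (at r0 within {0..1})"
      proof (rule has_field_derivative_transform_within[OF _ zero_less_one r0])
        show "- (?At t r 0 + ?A t r 0 * ?Ar t r 0 - (?B t r 0)\<^sup>2 / r) = ?pr t r 0" if "r \<in> {0..1}" for r
          using s.momentum_r[OF t that, of 0] C0[OF t that] by simp
      qed
      have peq: "p t r z = ?p t r z" if "r \<in> {0..1}" for r z
        using axP[OF t] that by (auto simp: axisymmetric_scalar_def)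
      have "partial_r (p t) r 0 = ?pr t r 0" if "r \<in> {0..1}" for r
        by (rule partial_r_eq[where g = "?p t"]) (use s.p[OF t] that peq in \<open>auto simp: C1_rz_def\<close>)
      then have "partial_r (partial_r (p t)) r0 0 = - (Utr (t, cyl r0 0 0) $ 1 + (?Ar t r0 0)\<^sup>2)"
        by (rule partial_r_eq[where g = "?pr t", OF dpr r0])
      then show "Utr (t, cyl r0 0 0) $ 1 \<le> - (?Ar t r0 0)\<^sup>2" using r(1)[OF t] by simp
    next
      have "partial_r (a 0) r0 0 = ?Ar 0 r0 0"
        by (rule partial_r_eq[where g = "?A 0", OF d(2)[OF _ r0] r0]) (use axisymmetric_fieldD(1)[OF ax[of 0]] in auto)
      then show "?Ar 0 r0 0 < 0" using r(2) by simp
    qed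
  qed
qed

end
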